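(* Let $\mathfrak g$ be a finite-dimensional real unimodular solvable Lie algebra whose nilradical $\mathfrak n$ is abelian. Then there exists an inner product on $\mathfrak g$ having a geodesic basis.
   Context: For an inner product $\langle\cdot,\cdot\rangle$ on a real Lie algebra $\mathfrak g$, a nonzero $X\in\mathfrak g$ is a geodesic element if $\langle X,[X,Y]\rangle=0$ for all $Y\in\mathfrak g$. A basis of $\mathfrak g$ is a geodesic basis (for that inner product) if each of its elements is a geodesic element. A Lie algebra is unimodular if $\operatorname{Tr}(\operatorname{ad}(X))=0$ for all $X\in\mathfrak g$. The nilradical is the maximal nilpotent ideal. *)

theory Defs
  imports "HOL-Analysis.Analysis"
begin

text \<open>A finite-dimensional real Lie algebra is modelled as a bracket on the
  underlying finite-dimensional real vector space of a type of class
  euclidean_space (its built-in inner product is only used to compute traces;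
  the inner products of the theorem are arbitrary).\<close>

definition lie_algebra :: "('a::euclidean_space \<Rightarrow> 'a \<Rightarrow> 'a) \<Rightarrow> bool" where
  "lie_algebra br \<longleftrightarrow> bilinear br \<and> (\<forall>x. br x x = 0) \<and>
     (\<forall>x y z. br x (br y z) + br y (br z x) + br z (br x y) = 0)"

definition trace_map :: "('a::euclidean_space \<Rightarrow> 'a) \<Rightarrow> real" where
  "trace_map f = (\<Sum>b\<in>Basis. f b \<bullet> b)"

definition unimodular :: "('a::euclidean_space \<Rightarrow> 'a \<Rightarrow> 'a) \<Rightarrow> bool" where
  "unimodular br \<longleftrightarrow> (\<forall>X. trace_map (br X) = 0)"

definition bracket_span :: "('a::euclidean_space \<Rightarrow> 'a \<Rightarrow> 'a) \<Rightarrow> 'a set \<Rightarrow> 'a set \<Rightarrow> 'a set" where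
  "bracket_span br S T = span {br x y | x y. x \<in> S \<and> y \<in> T}"

fun derived_series :: "('a::euclidean_space \<Rightarrow> 'a \<Rightarrow> 'a) \<Rightarrow> nat \<Rightarrow> 'a set" where
  "derived_series br 0 = UNIV"
| "derived_series br (Suc n) = bracket_span br (derived_series br n) (derived_series br n)"

definition solvable_lie :: "('a::euclidean_space \<Rightarrow> 'a \<Rightarrow> 'a) \<Rightarrow> bool" where
  "solvable_lie br \<longleftrightarrow> (\<exists>n. derived_series br n = {0})"

definition lie_ideal :: "('a::euclidean_space \<Rightarrow> 'a \<Rightarrow> 'a) \<Rightarrow> 'a set \<Rightarrow> bool" where
  "lie_ideal br I \<longleftrightarrow> subspace I \<and> (\<forall>x y. y \<in> I \<longrightarrow> br x y \<in> I)"

fun lower_central :: "('a::euclidean_space \<Rightarrow> 'a \<Rightarrow> 'a) \<Rightarrow> 'a set \<Rightarrow> nat \<Rightarrow> 'a set" where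
  "lower_central br I 0 = I"
| "lower_central br I (Suc n) = bracket_span br I (lower_central br I n)"

definition nilpotent_sub :: "('a::euclidean_space \<Rightarrow> 'a \<Rightarrow> 'a) \<Rightarrow> 'a set \<Rightarrow> bool" where
  "nilpotent_sub br I \<longleftrightarrow> (\<exists>n. lower_central br I n = {0})"

definition is_nilradical :: "('a::euclidean_space \<Rightarrow> 'a \<Rightarrow> 'a) \<Rightarrow> 'a set \<Rightarrow> bool" where
  "is_nilradical br N \<longleftrightarrow> lie_ideal br N \<and> nilpotent_sub br N \<and>
     (\<forall>M. lie_ideal br M \<and> nilpotent_sub br M \<longrightarrow> M \<subseteq> N)"

definition abelian_sub :: "('a::euclidean_space \<Rightarrow> 'a \<Rightarrow> 'a) \<Rightarrow> 'a set \<Rightarrow> bool" where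
  "abelian_sub br N \<longleftrightarrow> (\<forall>x\<in>N. \<forall>y\<in>N. br x y = 0)"

definition inner_product_on :: "('a::euclidean_space \<Rightarrow> 'a \<Rightarrow> real) \<Rightarrow> bool" where
  "inner_product_on ip \<longleftrightarrow> bilinear ip \<and> (\<forall>x y. ip x y = ip y x) \<and>
     (\<forall>x. x \<noteq> 0 \<longrightarrow> ip x x > 0)"

definition geodesic_element ::
  "('a::euclidean_space \<Rightarrow> 'a \<Rightarrow> real) \<Rightarrow> ('a \<Rightarrow> 'a \<Rightarrow> 'a) \<Rightarrow> 'a \<Rightarrow> bool" where
  "geodesic_element ip br X \<longleftrightarrow> X \<noteq> 0 \<and> (\<forall>Y. ip X (br X Y) = 0)"

definition geodesic_basis ::
  "('a::euclidean_space \<Rightarrow> 'a \<Rightarrow> real) \<Rightarrow> ('a \<Rightarrow> 'a \<Rightarrow> 'a) \<Rightarrow> 'a set \<Rightarrow> bool" where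
  "geodesic_basis ip br B \<longleftrightarrow> independent B \<and> span B = UNIV \<and>
     (\<forall>X\<in>B. geodesic_element ip br X)"

end

theory Submission
  imports Defs "HOL-Computational_Algebra.Fundamental_Theorem_Algebra"
begin

text \<open>
  For a solvable algebra with abelian nilradical \<open>N\<close> one has \<open>[g,g] \<subseteq> N\<close>, so the operators
  \<open>ad X\<close> commute on \<open>N\<close> and are traceless there. Decompose \<open>N\<close> into indecomposable summands
  \<open>N\<^sub>i\<close>: on each, the generalised eigenvalues of \<open>ad X\<close> have one common real part \<open>\<lambda>\<^sub>i(X)\<close>, and
  lifting eigenvectors of the simple quotients along an invariant flag gives a basis of \<open>N\<^sub>i\<close> in
  which the matrix of every \<open>ad X\<close> has constant diagonal \<open>\<lambda>\<^sub>i(X)\<close>. Declare the union of these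
  bases orthonormal. For basis vectors \<open>e\<^sub>i\<close> of \<open>N\<^sub>i\<close> the vectors \<open>\<Sum>\<^sub>i \<plusminus> sqrt (dim N\<^sub>i) e\<^sub>i\<close> are
  geodesic, because their quadratic form is the trace of \<open>ad X\<close> on \<open>N\<close>, and the choices of sign
  make them span \<open>N\<close>. Every vector orthogonal to \<open>N\<close> is geodesic since \<open>[g,g] \<subseteq> N\<close>.
\<close>

section \<open>Polynomials in an operator\<close>

lemma linear_funpow:
  fixes A :: "'a::real_vector \<Rightarrow> 'a"
  assumes "linear A"
  shows "linear (A ^^ k)"
proof (induction k)
  case 0
  show ?case by (simp add: linear_id[unfolded id_def] id_def)
next
  case (Suc k)
  then show ?case using assms by (simp add: linear_compose del: o_apply)
qed

lemma funpow_closed: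
  assumes "\<And>x. x \<in> W \<Longrightarrow> A x \<in> W" "x \<in> W"
  shows "(A ^^ k) x \<in> W"
  using assms by (induction k) auto

definition poly_map :: "('a::real_vector \<Rightarrow> 'a) \<Rightarrow> real poly \<Rightarrow> 'a \<Rightarrow> 'a" where
  "poly_map A p x = (\<Sum>i\<le>degree p. coeff p i *\<^sub>R (A ^^ i) x)"

lemma poly_map_0 [simp]: "poly_map A 0 x = 0"
  by (simp add: poly_map_def)

lemma poly_map_pCons:
  assumes "linear A"
  shows "poly_map A (pCons c p) x = c *\<^sub>R x + A (poly_map A p x)"
proof (cases "p = 0")
  case True
  then show ?thesis using assms by (simp add: poly_map_def linear_0)
next
  case False
  then show ?thesis
    using assms
    by (simp add: poly_map_def sum.atMost_Suc_shift linear_sum linear_cmul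
        del: sum.atMost_Suc)
qed

lemma poly_map_1 [simp]: "poly_map A 1 x = x"
  by (simp add: poly_map_def)

lemma poly_map_add:
  assumes "linear A"
  shows "poly_map A (p + q) x = poly_map A p x + poly_map A q x"
  by (induction p q rule: poly_induct2)
    (simp_all add: poly_map_pCons assms linear_add algebra_simps)

lemma poly_map_smult:
  assumes "linear A"
  shows "poly_map A (smult c p) x = c *\<^sub>R poly_map A p x"
  by (induction p) (simp_all add: poly_map_pCons assms linear_cmul algebra_simps)

lemma poly_map_mult:
  assumes "linear A"
  shows "poly_map A (p * q) x = poly_map A p (poly_map A q x)"
  by (induction p) (simp_all add: poly_map_pCons poly_map_add poly_map_smult assms)

lemma poly_map_monom:
  assumes "linear A"
  shows "poly_map A (monom c n) x = c *\<^sub>R (A ^^ n) x"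
  by (induction n) (simp_all add: monom_0 monom_Suc poly_map_pCons assms linear_0 linear_cmul)

lemma linear_poly_map:
  assumes "linear A"
  shows "linear (poly_map A p)"
  unfolding poly_map_def[abs_def]
  by (intro linear_compose_sum ballI linear_compose_scale_right linear_funpow assms)

lemma poly_map_closed:
  assumes "linear A" "subspace W" "\<And>x. x \<in> W \<Longrightarrow> A x \<in> W" "x \<in> W"
  shows "poly_map A p x \<in> W"
  by (induction p)
    (simp_all add: poly_map_pCons assms subspace_0 subspace_add subspace_mul)

lemma poly_map_commute:
  assumes "linear A" "linear B" "subspace W" "\<And>x. x \<in> W \<Longrightarrow> A x \<in> W"
    and "\<And>x. x \<in> W \<Longrightarrow> A (B x) = B (A x)" "x \<in> W"
  shows "poly_map A p (B x) = B (poly_map A p x)"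
  by (induction p)
    (simp_all add: poly_map_pCons poly_map_closed assms linear_0 linear_add linear_cmul)

lemma exists_in_span_of_predecessors:
  fixes v :: "nat \<Rightarrow> 'a::euclidean_space"
  shows "\<exists>n. v n \<in> span (v ` {..<n})"
proof (rule ccontr)
  assume "\<nexists>n. v n \<in> span (v ` {..<n})"
  then have "dim (v ` {..<n}) = n" for n
    by (induction n) (simp_all add: lessThan_Suc dim_insert)
  from this[of "Suc DIM('a)"] show False
    using dim_subset_UNIV[of "v ` {..<Suc DIM('a)}"] by simp
qed

lemma exists_annihilating_poly_at:
  fixes A :: "'a::euclidean_space \<Rightarrow> 'a"
  assumes A: "linear A"
  shows "\<exists>p. p \<noteq> 0 \<and> poly_map A p x = 0"
proof -
  obtain n where n: "(A ^^ n) x \<in> span ((\<lambda>i. (A ^^ i) x) ` {..<n})"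
    using exists_in_span_of_predecessors[of "\<lambda>i. (A ^^ i) x"] by blast
  have "\<exists>q. coeff q n = 0 \<and> poly_map A q x = y"
    if "y \<in> span ((\<lambda>i. (A ^^ i) x) ` {..<n})" for y
    using that
  proof (induction rule: span_induct_alt)
    case base
    show ?case by (intro exI[of _ 0]) simp
  next
    case (step c y z)
    then obtain q i where "coeff q n = 0" "poly_map A q x = z" "i < n" "y = (A ^^ i) x" by blast
    then show ?case
      by (intro exI[of _ "monom c i + q"]) (simp add: poly_map_add poly_map_monom A)
  qed
  then obtain q where q: "coeff q n = 0" "poly_map A q x = (A ^^ n) x" using n by blast
  let ?p = "monom 1 n + smult (- 1) q"
  have "coeff ?p n = 1" using q by simp
  then have "?p \<noteq> 0" by (metis coeff_0 zero_neq_one)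
  moreover have "poly_map A ?p x = 0"
    unfolding poly_map_add[OF A] poly_map_smult[OF A] poly_map_monom[OF A] using q by simp
  ultimately show ?thesis by blast
qed

lemma exists_annihilating_poly:
  fixes A :: "'a::euclidean_space \<Rightarrow> 'a"
  assumes A: "linear A"
  shows "\<exists>p. p \<noteq> 0 \<and> (\<forall>x. poly_map A p x = 0)"
proof -
  obtain q where q: "\<And>b. q b \<noteq> 0" "\<And>b. poly_map A (q b) b = 0"
    using exists_annihilating_poly_at[OF A] by metis
  define p where "p = (\<Prod>b\<in>Basis. q b)"
  have "poly_map A p b = 0" if "b \<in> Basis" for b
  proof -
    have "p = (\<Prod>b\<in>Basis - {b}. q b) * q b"
      using prod.remove[OF finite_Basis that, of q] by (simp add: p_def mult.commute)
    then show ?thesis using q by (simp add: poly_map_mult A linear_0 linear_poly_map)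
  qed
  then have "poly_map A p = (\<lambda>x. 0)"
    by (intro linear_eq_stdbasis linear_poly_map A linear_zero)
  moreover have "p \<noteq> 0" using q by (simp add: p_def)
  ultimately show ?thesis by (metis (no_types))
qed

section \<open>Commutators commuting with a factor are nilpotent\<close>

definition nilpotent_on :: "'a::zero set \<Rightarrow> ('a \<Rightarrow> 'a) \<Rightarrow> bool" where
  "nilpotent_on W T \<longleftrightarrow> (\<exists>k. \<forall>x\<in>W. (T ^^ k) x = 0)"

lemma nilpotent_on_subset: "nilpotent_on W T \<Longrightarrow> U \<subseteq> W \<Longrightarrow> nilpotent_on U T"
  unfolding nilpotent_on_def by blast

locale commutator_commuting =
  fixes T X :: "'a::euclidean_space \<Rightarrow> 'a" and W :: "'a set" and R :: "'a \<Rightarrow> 'a"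
  assumes T: "linear T" and X: "linear X" and W: "subspace W"
    and TW: "x \<in> W \<Longrightarrow> T x \<in> W" and XW: "x \<in> W \<Longrightarrow> X x \<in> W"
    and R: "R x = T (X x) - X (T x)"
    and TR: "x \<in> W \<Longrightarrow> T (R x) = R (T x)"
begin

lemma linear_commutator: "linear R"
  using linear_compose_sub[OF linear_compose[OF X T] linear_compose[OF T X]]
  by (simp add: R[abs_def] o_def)

lemma commutator_closed: "x \<in> W \<Longrightarrow> R x \<in> W"
  unfolding R by (intro subspace_diff W TW XW)

lemma poly_map_commute_commutator:
  "x \<in> W \<Longrightarrow> poly_map T p ((R ^^ k) x) = (R ^^ k) (poly_map T p x)"
proof (rule poly_map_commute[OF T linear_funpow[OF linear_commutator] W TW])
  show "T ((R ^^ k) x) = (R ^^ k) (T x)" if "x \<in> W" for x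
    using that TR funpow_closed[OF commutator_closed] by (induction k) auto
qed

lemma poly_map_commutator:
  "x \<in> W \<Longrightarrow> poly_map T p (X x) - X (poly_map T p x) = poly_map T (pderiv p) (R x)"
proof (induction p arbitrary: x)
  case 0
  show ?case using X by (simp add: linear_0)
next
  case (pCons c p)
  have "T (poly_map T p (X x)) - X (T (poly_map T p x))
      = R (poly_map T p x) + T (poly_map T p (X x) - X (poly_map T p x))"
    using T by (simp add: R linear_diff)
  also have "\<dots> = poly_map T p (R x) + T (poly_map T (pderiv p) (R x))"
    unfolding pCons.IH[OF pCons.prems] using poly_map_commute_commutator[OF pCons.prems, of p 1] by simp
  finally show ?case
    using T X by (simp add: poly_map_pCons pderiv_pCons poly_map_add linear_add linear_cmul)
qed

text \<open>Jacobson's lemma. If \<open>p(T)\<close> vanishes, commuting repeatedly with \<open>X\<close> yields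
  \<open>p\<^sup>(\<^sup>k\<^sup>)(T) R\<^sup>m = 0\<close> for every \<open>k\<close> and some \<open>m\<close>, and the last nonzero derivative of \<open>p\<close> is a constant.\<close>

lemma commutator_nilpotent_if_poly_map_vanishes:
  assumes "p \<noteq> 0" "\<And>x. x \<in> W \<Longrightarrow> poly_map T p ((R ^^ m) x) = 0"
  shows "nilpotent_on W R"
  using assms
proof (induction "degree p" arbitrary: p m)
  case 0
  then obtain c where "p = [:c:]" "c \<noteq> 0"
    by (metis degree_eq_zeroE pCons_eq_0_iff)
  with 0 show ?case using T by (auto simp: nilpotent_on_def poly_map_pCons linear_0)
next
  case (Suc n)
  note comm = poly_map_commute_commutator
  have "poly_map T (pderiv p) ((R ^^ (m + Suc m)) x) = 0" if x: "x \<in> W" for x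
  proof -
    let ?y = "(R ^^ m) x"
    have y: "?y \<in> W" using funpow_closed[OF commutator_closed x] .
    have "poly_map T (pderiv p) (R ?y) = poly_map T p (X ?y) - X (poly_map T p ?y)"
      using poly_map_commutator[OF y] by simp
    also have "\<dots> = poly_map T p (X ?y)" using Suc.prems x X by (simp add: linear_0)
    finally have "(R ^^ m) (poly_map T (pderiv p) (R ?y)) = 0"
      using comm[OF XW[OF y], of p m] Suc.prems(2)[OF XW[OF y]] by simp
    then show ?thesis
      using comm[OF commutator_closed[OF y], of "pderiv p" m] by (subst funpow_add) simp
  qed
  moreover have "pderiv p \<noteq> 0" "degree (pderiv p) = n"
    using Suc.hyps(2) by (auto simp: pderiv_eq_0_iff degree_pderiv)
  ultimately show ?case using Suc.hyps(1)[of "pderiv p" "m + Suc m"] by blast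
qed

lemma commutator_nilpotent: "nilpotent_on W R"
proof -
  obtain p where "p \<noteq> 0" "\<And>x. poly_map T p x = 0"
    using exists_annihilating_poly[OF T] by blast
  then show ?thesis by (rule commutator_nilpotent_if_poly_map_vanishes)
qed

end

section \<open>Real and complex eigenvalues of a real operator\<close>

definition conj_pair_poly :: "complex \<Rightarrow> real poly" where
  "conj_pair_poly z = [:(cmod z)\<^sup>2, - 2 * Re z, 1:]"

lemma poly_conj_pair_poly: "poly (conj_pair_poly z) x = (cmod (complex_of_real x - z))\<^sup>2"
  unfolding cmod_power2 by (simp add: conj_pair_poly_def cmod_def power2_eq_square algebra_simps)

lemma poly_map_conj_pair_poly:
  assumes "linear A"
  shows "poly_map A (conj_pair_poly z) x
    = (A (A x - Re z *\<^sub>R x) - Re z *\<^sub>R (A x - Re z *\<^sub>R x)) + (Im z)\<^sup>2 *\<^sub>R x"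
proof -
  have "(2 * Re z) *\<^sub>R A x = Re z *\<^sub>R A x + Re z *\<^sub>R A x" by (metis mult_2 scaleR_add_left)
  then show ?thesis
    using assms unfolding conj_pair_poly_def cmod_power2
    by (simp add: poly_map_pCons linear_0 linear_add linear_diff linear_cmul
        power2_eq_square algebra_simps)
qed

lemma square_eq_prod_conj_pair_poly:
  fixes p :: "real poly"
  obtains z where "p * p = smult ((lead_coeff p)\<^sup>2) (\<Prod>i<degree p. conj_pair_poly (z i))"
proof -
  define P where "P = map_poly complex_of_real p"
  have eval: "poly P (complex_of_real x) = complex_of_real (poly p x)" for x
    unfolding P_def by (induction p) (simp_all add: map_poly_pCons)
  obtain z where "smult (lead_coeff P) (\<Prod>i<degree P. [:- z i, 1:]) = P"
    by (rule complex_poly_decompose')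
  then have P: "P = smult (complex_of_real (lead_coeff p)) (\<Prod>i<degree p. [:- z i, 1:])"
    by (simp add: P_def degree_map_poly coeff_map_poly)
  have "poly (p * p) x = poly (smult ((lead_coeff p)\<^sup>2) (\<Prod>i<degree p. conj_pair_poly (z i))) x" for x
  proof -
    have "poly (p * p) x = (cmod (poly P (complex_of_real x)))\<^sup>2"
      by (simp add: eval power2_eq_square)
    also have "\<dots> = (lead_coeff p)\<^sup>2 * (\<Prod>i<degree p. (cmod (complex_of_real x - z i))\<^sup>2)"
      by (simp add: P poly_prod norm_mult prod_norm[symmetric] power_mult_distrib prod_power_distrib)
    finally show ?thesis by (simp add: poly_prod poly_conj_pair_poly)
  qed
  then have "p * p = smult ((lead_coeff p)\<^sup>2) (\<Prod>i<degree p. conj_pair_poly (z i))"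
    by (intro poly_eq_poly_eq_iff[THEN iffD1] ext)
  then show thesis by (rule that)
qed

lemma poly_map_prod_singular:
  fixes n :: nat
  assumes A: "linear A" and W: "subspace W" "\<And>x. x \<in> W \<Longrightarrow> A x \<in> W"
    and x: "x \<in> W" "x \<noteq> 0" "poly_map A (\<Prod>i<n. q i) x = 0"
  shows "\<exists>i<n. \<exists>y\<in>W. y \<noteq> 0 \<and> poly_map A (q i) y = 0"
  using x(3)
proof (induction n)
  case 0
  then show ?case using x by simp
next
  case (Suc n)
  let ?y = "poly_map A (\<Prod>i<n. q i) x"
  show ?case
  proof (cases "?y = 0")
    case True
    then show ?thesis using Suc.IH less_Suc_eq by blast
  next
    case False
    moreover have "?y \<in> W" using A W x(1) by (rule poly_map_closed)
    moreover have "poly_map A (q n) ?y = 0"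
      using Suc.prems by (simp add: mult.commute poly_map_mult A)
    ultimately show ?thesis by blast
  qed
qed

lemma exists_conj_pair_singular:
  fixes A :: "'a::euclidean_space \<Rightarrow> 'a"
  assumes A: "linear A" and W: "subspace W" "W \<noteq> {0}" and inv: "\<And>x. x \<in> W \<Longrightarrow> A x \<in> W"
  shows "\<exists>z. \<exists>x\<in>W. x \<noteq> 0 \<and> poly_map A (conj_pair_poly z) x = 0"
proof -
  obtain x where x: "x \<in> W" "x \<noteq> 0" using W subspace_0 by blast
  obtain p where p: "p \<noteq> 0" "poly_map A p x = 0" using exists_annihilating_poly_at[OF A] by blast
  obtain z where z: "p * p = smult ((lead_coeff p)\<^sup>2) (\<Prod>i<degree p. conj_pair_poly (z i))"
    by (rule square_eq_prod_conj_pair_poly)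
  have "poly_map A (p * p) x = 0" using p by (simp add: poly_map_mult A linear_0 linear_poly_map)
  then have "poly_map A (\<Prod>i<degree p. conj_pair_poly (z i)) x = 0"
    unfolding z using p(1) by (simp add: poly_map_smult A)
  then show ?thesis using poly_map_prod_singular[OF A W(1) inv x] by blast
qed

section \<open>Commuting families and their invariant subspaces\<close>

definition invariant_subspace :: "'i set \<Rightarrow> ('i \<Rightarrow> 'a::real_vector \<Rightarrow> 'a) \<Rightarrow> 'a set \<Rightarrow> bool" where
  "invariant_subspace I A V \<longleftrightarrow> subspace V \<and> (\<forall>i\<in>I. \<forall>x\<in>V. A i x \<in> V)"

lemma invariant_subspaceD:
  assumes "invariant_subspace I A V"
  shows "subspace V" "i \<in> I \<Longrightarrow> x \<in> V \<Longrightarrow> A i x \<in> V"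
  using assms unfolding invariant_subspace_def by blast+

lemma invariant_subspace_span:
  assumes "\<And>i. i \<in> I \<Longrightarrow> linear (A i)" "\<And>i x. i \<in> I \<Longrightarrow> x \<in> S \<Longrightarrow> A i x \<in> span S"
  shows "invariant_subspace I A (span S)"
  unfolding invariant_subspace_def
proof (intro conjI ballI subspace_span)
  fix i x assume "i \<in> I" "x \<in> span S"
  then have "A i x \<in> span (A i ` S)" using assms(1) linear_span_image by blast
  also have "\<dots> \<subseteq> span S" using assms(2) \<open>i \<in> I\<close> by (intro span_minimal) auto
  finally show "A i x \<in> span S" .
qed

definition commuting_family :: "'i set \<Rightarrow> ('i \<Rightarrow> 'a::real_vector \<Rightarrow> 'a) \<Rightarrow> 'a set \<Rightarrow> bool" where
  "commuting_family I A W \<longleftrightarrow> (\<forall>i\<in>I. linear (A i)) \<and> invariant_subspace I A W \<and>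
     (\<forall>i\<in>I. \<forall>j\<in>I. \<forall>x\<in>W. A i (A j x) = A j (A i x))"

lemma commuting_familyD:
  assumes "commuting_family I A W"
  shows "i \<in> I \<Longrightarrow> linear (A i)" "invariant_subspace I A W"
    "i \<in> I \<Longrightarrow> j \<in> I \<Longrightarrow> x \<in> W \<Longrightarrow> A i (A j x) = A j (A i x)"
  using assms unfolding commuting_family_def by blast+

lemma commuting_family_subset:
  assumes "commuting_family I A W" "invariant_subspace I A V" "V \<subseteq> W"
  shows "commuting_family I A V"
  using assms unfolding commuting_family_def by blast

definition commutant :: "'i set \<Rightarrow> ('i \<Rightarrow> 'a::real_vector \<Rightarrow> 'a) \<Rightarrow> 'a set \<Rightarrow> ('a \<Rightarrow> 'a) set" where
  "commutant I A W = {S. linear S \<and> (\<forall>x\<in>W. S x \<in> W) \<and> (\<forall>i\<in>I. \<forall>x\<in>W. S (A i x) = A i (S x))}"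

lemma commutantD:
  assumes "S \<in> commutant I A W"
  shows "linear S" "x \<in> W \<Longrightarrow> S x \<in> W" "i \<in> I \<Longrightarrow> x \<in> W \<Longrightarrow> S (A i x) = A i (S x)"
  using assms unfolding commutant_def by blast+

lemma commuting_family_in_commutant:
  assumes "commuting_family I A W" "i \<in> I"
  shows "A i \<in> commutant I A W"
  using assms by (auto simp: commutant_def commuting_family_def invariant_subspace_def)

lemma commutant_poly_map:
  assumes A: "commuting_family I A W" and S: "S \<in> commutant I A W"
  shows "poly_map S p \<in> commutant I A W"
proof -
  note W = commuting_familyD(2)[OF A] and D = commutantD[OF S]
  have "poly_map S p (A i x) = A i (poly_map S p x)" if "i \<in> I" "x \<in> W" for i x
    using poly_map_commute[OF D(1) commuting_familyD(1)[OF A that(1)] invariant_subspaceD(1)[OF W] D(2)]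
      D(3) that by blast
  then show ?thesis
    using D(1,2) linear_poly_map poly_map_closed[OF D(1) invariant_subspaceD(1)[OF W] D(2)]
    by (auto simp: commutant_def)
qed

lemma commutant_funpow:
  assumes A: "commuting_family I A W" and S: "S \<in> commutant I A W"
  shows "S ^^ k \<in> commutant I A W"
proof -
  have "S ^^ k = poly_map S (monom 1 k)"
    using commutantD(1)[OF S] by (simp add: fun_eq_iff poly_map_monom)
  then show ?thesis using commutant_poly_map[OF A S] by metis
qed

lemma commutant_add_scaleR:
  assumes A: "commuting_family I A W" and "S \<in> commutant I A W" "T \<in> commutant I A W"
  shows "(\<lambda>x. S x + c *\<^sub>R T x) \<in> commutant I A W"
  unfolding commutant_def
proof (intro CollectI conjI ballI)
  show "linear (\<lambda>x. S x + c *\<^sub>R T x)"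
    using assms(2,3) commutantD(1) by (intro linear_compose_add linear_compose_scale_right)
  show "S x + c *\<^sub>R T x \<in> W" if "x \<in> W" for x
    using invariant_subspaceD(1)[OF commuting_familyD(2)[OF A]] commutantD(2)[OF assms(2) that]
      commutantD(2)[OF assms(3) that]
    by (intro subspace_add subspace_scale)
  show "S (A i x) + c *\<^sub>R T (A i x) = A i (S x + c *\<^sub>R T x)" if "i \<in> I" "x \<in> W" for i x
    using that commutantD(3)[OF assms(2) that] commutantD(3)[OF assms(3) that]
      commuting_familyD(1)[OF A that(1)]
    by (simp add: linear_add linear_cmul)
qed

lemma invariant_subspace_kernel:
  assumes A: "commuting_family I A W" and S: "S \<in> commutant I A W"
  shows "invariant_subspace I A {x \<in> W. S x = 0}"
proof -
  note W = commuting_familyD(2)[OF A] and D = commutantD[OF S]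
  have "subspace {x \<in> W. S x = 0}"
    using linear_subspace_kernel[OF D(1)] invariant_subspaceD(1)[OF W] subspace_inter
    by (simp add: Collect_conj_eq)
  then show ?thesis
    using D(3) invariant_subspaceD(2)[OF W] linear_0[OF commuting_familyD(1)[OF A]]
    by (auto simp: invariant_subspace_def)
qed

lemma invariant_subspace_image:
  assumes A: "commuting_family I A W" and S: "S \<in> commutant I A W"
  shows "invariant_subspace I A (S ` W)"
proof -
  note W = commuting_familyD(2)[OF A] and D = commutantD[OF S]
  have "A i (S x) \<in> S ` W" if "i \<in> I" "x \<in> W" for i x
    using D(3)[OF that] invariant_subspaceD(2)[OF W that] by (metis imageI)
  then show ?thesis
    using linear_subspace_image[OF D(1) invariant_subspaceD(1)[OF W]]
    by (auto simp: invariant_subspace_def)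
qed

definition maximal_invariant :: "'i set \<Rightarrow> ('i \<Rightarrow> 'a::real_vector \<Rightarrow> 'a) \<Rightarrow> 'a set \<Rightarrow> 'a set \<Rightarrow> bool" where
  "maximal_invariant I A W V \<longleftrightarrow> invariant_subspace I A V \<and> V \<subset> W \<and>
     (\<forall>V'. invariant_subspace I A V' \<and> V \<subseteq> V' \<and> V' \<subseteq> W \<longrightarrow> V' = V \<or> V' = W)"

lemma maximal_invariantD:
  assumes "maximal_invariant I A W V"
  shows "invariant_subspace I A V" "V \<subset> W"
    "invariant_subspace I A V' \<Longrightarrow> V \<subset> V' \<Longrightarrow> V' \<subseteq> W \<Longrightarrow> V' = W"
  using assms unfolding maximal_invariant_def by blast+

lemma maximal_invariant_span_eq:
  assumes A: "commuting_family I A W" and V: "maximal_invariant I A W V"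
    and E: "E \<subseteq> W" "V \<subseteq> span E" "v \<in> E" "v \<notin> V"
    and inv: "\<And>i e. i \<in> I \<Longrightarrow> e \<in> E \<Longrightarrow> A i e \<in> span E"
  shows "span E = W"
proof (rule maximal_invariantD(3)[OF V])
  show "invariant_subspace I A (span E)"
    using commuting_familyD(1)[OF A] inv by (intro invariant_subspace_span)
  show "V \<subset> span E" using E(2-4) span_base[of v E] by blast
  show "span E \<subseteq> W"
    using E(1) invariant_subspaceD(1)[OF commuting_familyD(2)[OF A]] by (rule span_minimal)
qed

lemma dim_psubset_subspaces:
  fixes U W :: "'a::euclidean_space set"
  assumes "subspace U" "subspace W" "U \<subset> W"
  shows "dim U < dim W"
  using assms by (intro dim_psubset) (simp add: span_eq_iff[THEN iffD2])

lemma maximal_invariant_dim_less: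
  fixes A :: "'i \<Rightarrow> 'a::euclidean_space \<Rightarrow> 'a"
  assumes "commuting_family I A W" "maximal_invariant I A W V"
  shows "dim V < dim W"
  using dim_psubset_subspaces commuting_familyD(2)[OF assms(1)] maximal_invariantD(1,2)[OF assms(2)]
  unfolding invariant_subspace_def by blast

lemma exists_maximal_invariant:
  fixes A :: "'i \<Rightarrow> 'a::euclidean_space \<Rightarrow> 'a"
  assumes A: "commuting_family I A W" and W: "W \<noteq> {0}"
  shows "\<exists>V. maximal_invariant I A W V"
proof -
  define Q where "Q V \<longleftrightarrow> invariant_subspace I A V \<and> V \<subset> W" for V
  note D = commuting_familyD[OF A]
  have "Q {0}"
    using W linear_0[OF D(1)] subspace_0[OF invariant_subspaceD(1)[OF D(2)]]
    by (auto simp: Q_def invariant_subspace_def subspace_single_0)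
  moreover have "\<forall>V. Q V \<longrightarrow> dim V < Suc DIM('a)"
    by (simp add: dim_subset_UNIV le_imp_less_Suc)
  ultimately obtain V where V: "Q V" "\<And>V'. Q V' \<Longrightarrow> dim V' \<le> dim V"
    using ex_has_greatest_nat[of Q "{0}" dim "Suc DIM('a)"] by blast
  have "V' = V \<or> V' = W" if V': "invariant_subspace I A V'" "V \<subseteq> V'" "V' \<subseteq> W" for V'
  proof (rule ccontr)
    assume "\<not> (V' = V \<or> V' = W)"
    then have "V \<subset> V'" "Q V'" using V' by (auto simp: Q_def)
    then have "dim V < dim V'"
      using V(1) by (intro dim_psubset_subspaces) (simp_all add: Q_def invariant_subspace_def)
    then show False using V(2)[OF \<open>Q V'\<close>] by simp
  qed
  then have "maximal_invariant I A W V"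
    unfolding maximal_invariant_def using V(1) by (simp add: Q_def)
  then show ?thesis by (rule exI)
qed

text \<open>The quotient \<open>W/V\<close> is simple, so by Schur's lemma its commutant has no zero divisors.\<close>

lemma maximal_invariant_prime:
  assumes A: "commuting_family I A W" and V: "maximal_invariant I A W V"
    and S: "S \<in> commutant I A W" and T: "linear T" "\<And>x. x \<in> V \<Longrightarrow> T x \<in> V"
    and TS: "\<And>x. x \<in> W \<Longrightarrow> T (S x) \<in> V"
  shows "(\<forall>x\<in>W. S x \<in> V) \<or> (\<forall>x\<in>W. T x \<in> V)"
proof (cases "\<forall>x\<in>W. S x \<in> V")
  case False
  then obtain y where y: "y \<in> W" "S y \<notin> V" by blast
  note VD = maximal_invariantD[OF V]
  have V_sub: "subspace V" using invariant_subspaceD(1)[OF VD(1)] .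
  have SW: "invariant_subspace I A (S ` W)" using invariant_subspace_image[OF A S] .
  have "span (V \<union> S ` W) = W"
  proof (rule maximal_invariant_span_eq[OF A V _ _ _ y(2)])
    show "V \<union> S ` W \<subseteq> W" using VD(2) commutantD(2)[OF S] by auto
    show "V \<subseteq> span (V \<union> S ` W)" "S y \<in> V \<union> S ` W" using span_superset[of "V \<union> S ` W"] y(1) by auto
    show "A i x \<in> span (V \<union> S ` W)" if "i \<in> I" "x \<in> V \<union> S ` W" for i x
      using that(2) invariant_subspaceD(2)[OF VD(1) that(1)] invariant_subspaceD(2)[OF SW that(1)]
      by (intro span_base) blast
  qed
  moreover have "span V = V" "span (S ` W) = S ` W"
    using V_sub invariant_subspaceD(1)[OF SW] by (simp_all add: span_eq_iff[THEN iffD2])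
  ultimately have "\<exists>v\<in>V. \<exists>z\<in>W. x = v + S z" if "x \<in> W" for x using that by (force simp: span_Un)
  then have "\<forall>x\<in>W. T x \<in> V" using T TS V_sub by (metis linear_add subspace_add)
  then show ?thesis ..
qed simp

lemma maximal_invariant_square_zero:
  assumes A: "commuting_family I A W" and V: "maximal_invariant I A W V" and i: "i \<in> I"
    and square: "\<And>x. x \<in> W \<Longrightarrow> A i (A i x) \<in> V" and x: "x \<in> W"
  shows "A i x \<in> V"
proof -
  have "(\<forall>x\<in>W. A i x \<in> V) \<or> (\<forall>x\<in>W. A i x \<in> V)"
    using commuting_family_in_commutant[OF A i] commuting_familyD(1)[OF A i]
      invariant_subspaceD(2)[OF maximal_invariantD(1)[OF V] i] square
    by (rule maximal_invariant_prime[OF A V])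
  then show ?thesis using x by blast
qed

lemma maximal_invariant_nilpotent:
  assumes A: "commuting_family I A W" and V: "maximal_invariant I A W V"
    and S: "S \<in> commutant I A W" "\<And>x. x \<in> V \<Longrightarrow> S x \<in> V" and nil: "nilpotent_on W S"
  shows "\<forall>x\<in>W. S x \<in> V"
proof -
  obtain k where k: "\<And>x. x \<in> W \<Longrightarrow> (S ^^ k) x = 0" using nil by (auto simp: nilpotent_on_def)
  have "\<forall>x\<in>W. S x \<in> V" if "\<forall>x\<in>W. (S ^^ n) x \<in> V" for n
    using that
  proof (induction n)
    case 0
    then show ?case using commutantD(2)[OF S(1)] by simp
  next
    case (Suc n)
    have "(\<forall>x\<in>W. S x \<in> V) \<or> (\<forall>x\<in>W. (S ^^ n) x \<in> V)"
    proof (rule maximal_invariant_prime[OF A V S(1)])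
      show "linear (S ^^ n)" using linear_funpow[OF commutantD(1)[OF S(1)]] .
      show "(S ^^ n) x \<in> V" if "x \<in> V" for x using S(2) that by (rule funpow_closed)
      show "(S ^^ n) (S x) \<in> V" if "x \<in> W" for x
        using Suc.prems that by (simp add: funpow_swap1)
    qed
    then show ?case using Suc.IH by blast
  qed
  moreover have "0 \<in> V"
    using invariant_subspaceD(1)[OF maximal_invariantD(1)[OF V]] by (rule subspace_0)
  ultimately show ?thesis using k by metis
qed

definition nilpotent_flag ::
  "'i set \<Rightarrow> ('i \<Rightarrow> 'a::real_vector \<Rightarrow> 'a) \<Rightarrow> 'a set \<Rightarrow> (nat \<Rightarrow> 'a set) \<Rightarrow> bool" where
  "nilpotent_flag I A W L \<longleftrightarrow> L 0 = W \<and> (\<exists>n. L n = {0}) \<and>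
     (\<forall>j. subspace (L j) \<and> L j \<subseteq> W \<and> (\<forall>i\<in>I. \<forall>x\<in>L j. A i x \<in> L (Suc j)))"

lemma nilpotent_flagD:
  assumes "nilpotent_flag I A W L"
  shows "L 0 = W" "\<exists>n. L n = {0}" "subspace (L j)" "L j \<subseteq> W" "i \<in> I \<Longrightarrow> x \<in> L j \<Longrightarrow> A i x \<in> L (Suc j)"
  using assms unfolding nilpotent_flag_def by blast+

lemma nilpotent_flag_Cons:
  assumes L: "nilpotent_flag I A V L" and W: "subspace W" "V \<subseteq> W"
    and WV: "\<And>i x. i \<in> I \<Longrightarrow> x \<in> W \<Longrightarrow> A i x \<in> V"
  shows "nilpotent_flag I A W (case_nat W L)"
proof -
  note LD = nilpotent_flagD[OF L]
  obtain n where "L n = {0}" using LD(2) by blast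
  then have "\<exists>n. case_nat W L n = {0}" by (intro exI[of _ "Suc n"]) simp
  moreover have "subspace (case_nat W L j)" "case_nat W L j \<subseteq> W" for j
    using LD(3,4) W by (auto split: nat.split)
  moreover have "A i x \<in> case_nat W L (Suc j)" if "i \<in> I" "x \<in> case_nat W L j" for i x j
    using that LD(1,5) WV by (cases j) simp_all
  ultimately show ?thesis by (simp add: nilpotent_flag_def)
qed

lemma commuting_nilpotent_flag:
  fixes A :: "'i \<Rightarrow> 'a::euclidean_space \<Rightarrow> 'a"
  assumes "commuting_family I A W" "\<And>i. i \<in> I \<Longrightarrow> nilpotent_on W (A i)"
  shows "\<exists>L. nilpotent_flag I A W L"
  using assms
proof (induction "dim W" arbitrary: W rule: less_induct)
  case less
  note D = commuting_familyD[OF less.prems(1)]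
  show ?case
  proof (cases "W = {0}")
    case True
    then have "nilpotent_flag I A W (\<lambda>_. W)"
      using invariant_subspaceD[OF D(2)] by (simp add: nilpotent_flag_def)
    then show ?thesis by blast
  next
    case False
    then obtain V where V: "maximal_invariant I A W V"
      using exists_maximal_invariant[OF less.prems(1)] by blast
    note VD = maximal_invariantD[OF V]
    have WV: "A i x \<in> V" if i: "i \<in> I" and x: "x \<in> W" for i x
    proof -
      have "A i \<in> commutant I A W" using less.prems(1) i by (rule commuting_family_in_commutant)
      then have "\<forall>x\<in>W. A i x \<in> V"
        using less.prems(2)[OF i] invariant_subspaceD(2)[OF VD(1) i]
        by (intro maximal_invariant_nilpotent[OF less.prems(1) V])
      then show ?thesis using x by blast
    qed
    have "dim V < dim W" using maximal_invariant_dim_less[OF less.prems(1) V] .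
    moreover have "commuting_family I A V"
      using commuting_family_subset[OF less.prems(1)] VD by blast
    moreover have "nilpotent_on V (A i)" if "i \<in> I" for i
      using nilpotent_on_subset less.prems(2)[OF that] VD(2) by blast
    ultimately obtain L where "nilpotent_flag I A V L" using less.hyps[of V] by blast
    then have "nilpotent_flag I A W (case_nat W L)"
      using VD(2) WV invariant_subspaceD(1)[OF D(2)] by (intro nilpotent_flag_Cons) auto
    then show ?thesis by blast
  qed
qed

section \<open>Commuting operators with purely imaginary spectrum\<close>

text \<open>Equivalently, the complex eigenvalues of \<open>T\<close> on \<open>W\<close> are among \<open>\<plusminus>\<i>\<beta>\<close>.\<close>

definition imaginary_spectrum_on :: "'a::real_vector set \<Rightarrow> ('a \<Rightarrow> 'a) \<Rightarrow> real \<Rightarrow> bool" where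
  "imaginary_spectrum_on W T \<beta> \<longleftrightarrow> nilpotent_on W (\<lambda>x. T (T x) + \<beta>\<^sup>2 *\<^sub>R x)"

lemma maximal_invariant_square_scalar:
  assumes A: "commuting_family I A W" and V: "maximal_invariant I A W V"
    and imag: "\<And>i. i \<in> I \<Longrightarrow> imaginary_spectrum_on W (A i) (b i)"
    and i: "i \<in> I" and x: "x \<in> W"
  shows "A i (A i x) + (b i)\<^sup>2 *\<^sub>R x \<in> V"
proof -
  note lin = commuting_familyD(1)[OF A i] and VI = maximal_invariantD(1)[OF V]
  have eq: "poly_map (A i) [:(b i)\<^sup>2, 0, 1:] = (\<lambda>x. A i (A i x) + (b i)\<^sup>2 *\<^sub>R x)"
    using lin by (simp add: fun_eq_iff poly_map_pCons linear_0 add.commute)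
  have "\<forall>x\<in>W. poly_map (A i) [:(b i)\<^sup>2, 0, 1:] x \<in> V"
  proof (rule maximal_invariant_nilpotent[OF A V])
    show "poly_map (A i) [:(b i)\<^sup>2, 0, 1:] \<in> commutant I A W"
      using A i by (intro commutant_poly_map commuting_family_in_commutant)
    show "poly_map (A i) [:(b i)\<^sup>2, 0, 1:] x \<in> V" if "x \<in> V" for x
      using poly_map_closed[OF lin] invariant_subspaceD[OF VI] i that by blast
    show "nilpotent_on W (poly_map (A i) [:(b i)\<^sup>2, 0, 1:])"
      unfolding eq using imag[OF i] by (simp add: imaginary_spectrum_on_def)
  qed
  then show ?thesis using x unfolding eq by blast
qed

text \<open>Modulo \<open>V\<close> both \<open>A i\<close> and \<open>c A j\<close> with \<open>c = b i / b j\<close> square to \<open>- (b i)\<^sup>2\<close>, so the product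
  of \<open>A i - c A j\<close> and \<open>A i + c A j\<close> vanishes.\<close>

lemma maximal_invariant_proportional:
  assumes A: "commuting_family I A W" and V: "maximal_invariant I A W V"
    and imag: "\<And>i. i \<in> I \<Longrightarrow> imaginary_spectrum_on W (A i) (b i)"
    and i: "i \<in> I" and j: "j \<in> I" "b j \<noteq> 0"
  shows "\<exists>c. \<forall>x\<in>W. A i x - c *\<^sub>R A j x \<in> V"
proof -
  define c where "c = b i / b j"
  note VI = invariant_subspaceD[OF maximal_invariantD(1)[OF V]]
  note comm = commuting_family_in_commutant[OF A]
  note lin = commuting_familyD(1)[OF A i] commuting_familyD(1)[OF A j(1)]
  have minus: "(\<lambda>x. A i x - c *\<^sub>R A j x) \<in> commutant I A W"
    using commutant_add_scaleR[OF A comm[OF i] comm[OF j(1)], of "- c"] by simp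
  have plus: "(\<lambda>x. A i x + c *\<^sub>R A j x) \<in> commutant I A W"
    using commutant_add_scaleR[OF A comm[OF i] comm[OF j(1)], of c] .
  have "(\<forall>x\<in>W. A i x - c *\<^sub>R A j x \<in> V) \<or> (\<forall>x\<in>W. A i x + c *\<^sub>R A j x \<in> V)"
  proof (rule maximal_invariant_prime[OF A V minus commutantD(1)[OF plus]])
    show "A i x + c *\<^sub>R A j x \<in> V" if "x \<in> V" for x
      using that VI i j(1) by (simp add: subspace_add subspace_scale)
    fix x assume x: "x \<in> W"
    have "A i (A i x - c *\<^sub>R A j x) + c *\<^sub>R A j (A i x - c *\<^sub>R A j x)
        = A i (A i x) - (c * c) *\<^sub>R A j (A j x)"
      using commuting_familyD(3)[OF A i j(1) x] lin
      by (simp add: linear_diff linear_cmul algebra_simps)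
    also have "\<dots> = (A i (A i x) + (b i)\<^sup>2 *\<^sub>R x) - (c * c) *\<^sub>R (A j (A j x) + (b j)\<^sup>2 *\<^sub>R x)"
      using j(2) by (simp add: c_def power2_eq_square algebra_simps)
    also have "\<dots> \<in> V"
      using maximal_invariant_square_scalar[OF A V imag _ x] i j(1) VI(1)
      by (intro subspace_diff subspace_scale) blast+
    finally show "A i (A i x - c *\<^sub>R A j x) + c *\<^sub>R A j (A i x - c *\<^sub>R A j x) \<in> V" .
  qed
  moreover have "A i x + c *\<^sub>R A j x = A i x - (- c) *\<^sub>R A j x" for x by simp
  ultimately show ?thesis by metis
qed

text \<open>The matrix of \<open>A i\<close> in the basis \<open>E\<close> has a zero diagonal entry at \<open>e\<close> if and only if
  \<open>A i e \<in> span (E - {e})\<close>.\<close>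

definition zero_diagonal_basis :: "'i set \<Rightarrow> ('i \<Rightarrow> 'a::real_vector \<Rightarrow> 'a) \<Rightarrow> 'a set \<Rightarrow> bool" where
  "zero_diagonal_basis I A E \<longleftrightarrow> independent E \<and> (\<forall>i\<in>I. \<forall>e\<in>E. A i e \<in> span (E - {e}))"

lemma zero_diagonal_basisD:
  assumes "zero_diagonal_basis I A E"
  shows "independent E" "i \<in> I \<Longrightarrow> e \<in> E \<Longrightarrow> A i e \<in> span (E - {e})"
  using assms unfolding zero_diagonal_basis_def by blast+

lemma zero_diagonal_basis_extend:
  assumes F: "zero_diagonal_basis I A F" "span F = V"
    and V: "V \<subseteq> W" "subspace W" and WV: "\<And>i x. i \<in> I \<Longrightarrow> x \<in> W \<Longrightarrow> A i x \<in> V"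
  shows "\<exists>E. zero_diagonal_basis I A E \<and> span E = W"
proof -
  have "F \<subseteq> W" using F(2) V(1) span_superset by blast
  then obtain E where E: "F \<subseteq> E" "E \<subseteq> W" "independent E" "W \<subseteq> span E"
    using maximal_independent_subset_extend zero_diagonal_basisD(1)[OF F(1)] by metis
  have "A i e \<in> span (E - {e})" if "i \<in> I" "e \<in> E" for i e
  proof (cases "e \<in> F")
    case True
    have "span (F - {e}) \<subseteq> span (E - {e})" using E(1) by (intro span_mono) blast
    then show ?thesis using zero_diagonal_basisD(2)[OF F(1) that(1) True] by (rule subsetD)
  next
    case False
    then have "span F \<subseteq> span (E - {e})" using E(1) by (intro span_mono) blast
    then show ?thesis using WV that E(2) F(2) by blast
  qed
  moreover have "span E = W" using E(2,4) V(2) span_minimal by blast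
  ultimately show ?thesis using E(3) unfolding zero_diagonal_basis_def by blast
qed

lemma zero_diagonal_basis_insert_pair:
  assumes F: "zero_diagonal_basis I A F"
    and v: "v \<notin> span F" and w: "w \<notin> span (insert v F)"
    and Av: "\<And>i. i \<in> I \<Longrightarrow> A i v \<in> span (insert w F)"
    and Aw: "\<And>i. i \<in> I \<Longrightarrow> A i w \<in> span (insert v F)"
  shows "zero_diagonal_basis I A (insert w (insert v F))" (is "zero_diagonal_basis I A ?E")
  unfolding zero_diagonal_basis_def
proof (intro conjI ballI)
  show "independent ?E" using zero_diagonal_basisD(1)[OF F] v w by (intro independent_insertI)
  have "v \<notin> F" "w \<notin> insert v F" using v w span_base by metis+
  then have remove: "?E - {v} = insert w F" "?E - {w} = insert v F" by auto
  fix i e assume i: "i \<in> I" and "e \<in> ?E"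
  then consider "e = v" | "e = w" | "e \<in> F" by auto
  then show "A i e \<in> span (?E - {e})"
  proof cases
    case 3
    have "span (F - {e}) \<subseteq> span (?E - {e})" by (intro span_mono) auto
    then show ?thesis using zero_diagonal_basisD(2)[OF F i 3] by (rule subsetD)
  qed (simp_all add: remove Av Aw i)
qed

lemma no_real_eigenvector_modulo:
  assumes B: "linear B" and V: "subspace V" "\<And>x. x \<in> V \<Longrightarrow> B x \<in> V"
    and w: "w \<notin> V" "B (B w) + \<beta>\<^sup>2 *\<^sub>R w \<in> V" and \<beta>: "\<beta> \<noteq> 0"
  shows "B w - t *\<^sub>R w \<notin> V"
proof
  assume t: "B w - t *\<^sub>R w \<in> V"
  have "(B (B w) + \<beta>\<^sup>2 *\<^sub>R w) - B (B w - t *\<^sub>R w) - t *\<^sub>R (B w - t *\<^sub>R w) \<in> V"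
    using w(2) V(2)[OF t] subspace_scale[OF V(1) t] V(1) by (simp only: subspace_diff)
  also have "(B (B w) + \<beta>\<^sup>2 *\<^sub>R w) - B (B w - t *\<^sub>R w) - t *\<^sub>R (B w - t *\<^sub>R w) = (\<beta>\<^sup>2 + t\<^sup>2) *\<^sub>R w"
    using B by (simp add: linear_diff linear_cmul power2_eq_square algebra_simps)
  finally have "(1 / (\<beta>\<^sup>2 + t\<^sup>2)) *\<^sub>R (\<beta>\<^sup>2 + t\<^sup>2) *\<^sub>R w \<in> V" by (rule subspace_scale[OF V(1)])
  then show False using w(1) \<beta> by (simp add: sum_power2_eq_zero_iff)
qed

lemma zero_diagonal_basis_extend_complex:
  assumes A: "commuting_family I A W" and V: "maximal_invariant I A W V"
    and F: "zero_diagonal_basis I A F" "span F = V"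
    and j: "j \<in> I" "\<beta> \<noteq> 0" and square: "\<And>x. x \<in> W \<Longrightarrow> A j (A j x) + \<beta>\<^sup>2 *\<^sub>R x \<in> V"
    and proportional: "\<And>i. i \<in> I \<Longrightarrow> \<exists>c. \<forall>x\<in>W. A i x - c *\<^sub>R A j x \<in> V"
  shows "\<exists>E. zero_diagonal_basis I A E \<and> span E = W"
proof -
  note VD = maximal_invariantD[OF V] and lin = commuting_familyD(1)[OF A]
  note sub = invariant_subspaceD[OF VD(1)] and W = invariant_subspaceD[OF commuting_familyD(2)[OF A]]
  obtain v where v: "v \<in> W" "v \<notin> V" using VD(2) by blast
  define w where "w = A j v"
  have w: "w \<in> W" unfolding w_def using W(2) j(1) v(1) .
  have "w - t *\<^sub>R v \<notin> V" for t
    unfolding w_def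
    using no_real_eigenvector_modulo[OF lin[OF j(1)] sub(1) sub(2)[OF j(1)] v(2) square[OF v(1)] j(2)] .
  then have w_notin: "w \<notin> span (insert v F)" by (simp add: span_breakdown_eq F(2))
  have Av: "A i v \<in> span (insert w F)" if i: "i \<in> I" for i
  proof -
    obtain c where "A i v - c *\<^sub>R w \<in> V" unfolding w_def using proportional[OF i] v(1) by blast
    then show ?thesis by (auto simp: span_breakdown_eq F(2))
  qed
  have Aw: "A i w \<in> span (insert v F)" if i: "i \<in> I" for i
  proof -
    obtain c where c: "A i w - c *\<^sub>R A j w \<in> V" using proportional[OF i] w by blast
    have "(A i w - c *\<^sub>R A j w) + c *\<^sub>R (A j w + \<beta>\<^sup>2 *\<^sub>R v) \<in> V"
      using c square[OF v(1)] sub(1) unfolding w_def by (simp only: subspace_add subspace_scale)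
    then have "A i w - (- (c * \<beta>\<^sup>2)) *\<^sub>R v \<in> V" by (simp add: algebra_simps)
    then show ?thesis unfolding span_breakdown_eq F(2) by (rule exI)
  qed
  let ?E = "insert w (insert v F)"
  have E: "zero_diagonal_basis I A ?E"
    using F(2) v(2) by (intro zero_diagonal_basis_insert_pair[OF F(1) _ w_notin Av Aw]) simp
  have "span ?E = W"
  proof (rule maximal_invariant_span_eq[OF A V _ _ _ v(2)])
    show "?E \<subseteq> W" using v(1) w F(2) VD(2) span_superset[of F] by auto
    show "V \<subseteq> span ?E" unfolding F(2)[symmetric] by (intro span_mono) blast
    show "A i e \<in> span ?E" if "i \<in> I" "e \<in> ?E" for i e
      using span_mono[OF Diff_subset] zero_diagonal_basisD(2)[OF E that] by (rule subsetD)
  qed simp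
  then show ?thesis using E by blast
qed

lemma imaginary_family_zero_diagonal_basis:
  fixes A :: "'i \<Rightarrow> 'a::euclidean_space \<Rightarrow> 'a"
  assumes "commuting_family I A W"
    and "\<And>i. i \<in> I \<Longrightarrow> imaginary_spectrum_on W (A i) (b i)"
  shows "\<exists>E. zero_diagonal_basis I A E \<and> span E = W"
  using assms
proof (induction "dim W" arbitrary: W rule: less_induct)
  case less
  note A = less.prems(1) and imag = less.prems(2)
  note W = commuting_familyD(2)[OF A]
  show ?case
  proof (cases "W = {0}")
    case True
    then show ?thesis
      by (intro exI[of _ "{}"]) (simp add: zero_diagonal_basis_def independent_empty)
  next
    case False
    then obtain V where V: "maximal_invariant I A W V"
      using exists_maximal_invariant[OF A] by blast
    note VD = maximal_invariantD[OF V]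
    note square = maximal_invariant_square_scalar[OF A V imag]
    have "dim V < dim W" using maximal_invariant_dim_less[OF A V] .
    moreover have "commuting_family I A V" using commuting_family_subset[OF A] VD by blast
    moreover have "imaginary_spectrum_on V (A i) (b i)" if "i \<in> I" for i
      using nilpotent_on_subset imag[OF that] VD(2) unfolding imaginary_spectrum_on_def by blast
    ultimately obtain F where F: "zero_diagonal_basis I A F" "span F = V"
      using less.hyps[of V] by blast
    show ?thesis
    proof (cases "\<forall>i\<in>I. b i = 0")
      case True
      then have "A i (A i x) \<in> V" if "i \<in> I" "x \<in> W" for i x using square[OF _ that] that(1) by simp
      then have "A i x \<in> V" if "i \<in> I" "x \<in> W" for i x
        using maximal_invariant_square_zero[OF A V that(1) _ that(2)] that(1) by blast
      then show ?thesis
        using VD(2)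
        by (intro zero_diagonal_basis_extend[OF F _ invariant_subspaceD(1)[OF W]]) blast+
    next
      case False
      then obtain j where j: "j \<in> I" "b j \<noteq> 0" by blast
      show ?thesis
        by (rule zero_diagonal_basis_extend_complex[OF A V F j square[OF _ j(1)]
              maximal_invariant_proportional[OF A V imag _ j]])
    qed
  qed
qed

section \<open>Fitting's lemma\<close>

lemma exists_stable_funpow:
  fixes T :: "'a::euclidean_space \<Rightarrow> 'a"
  assumes T: "linear T" and W: "subspace W" and inv: "\<And>x. x \<in> W \<Longrightarrow> T x \<in> W"
  shows "\<exists>k>0. {x \<in> W. (T ^^ (k + k)) x = 0} = {x \<in> W. (T ^^ k) x = 0} \<and>
    (T ^^ (k + k)) ` W = (T ^^ k) ` W"
proof -
  note lin = linear_funpow[OF T] and closed = funpow_closed[OF inv]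
  define K R where "K k = {x \<in> W. (T ^^ k) x = 0}" and "R k = (T ^^ k) ` W" for k
  have subK: "subspace (K k)" for k
    using linear_subspace_kernel[OF lin] W by (simp add: K_def Collect_conj_eq subspace_inter)
  have subR: "subspace (R k)" for k
    unfolding R_def using linear_subspace_image[OF lin W] .
  define f where "f k = dim (R k) + (DIM('a) - dim (K k))" for k
  obtain k where "k > 0" and least: "\<And>j. j > 0 \<Longrightarrow> f k \<le> f j"
    using ex_has_least_nat[of "\<lambda>k. k > 0" 1 f] by auto
  have K: "K k \<subseteq> K (k + k)" using linear_0[OF lin] by (auto simp: K_def funpow_add)
  have R: "R (k + k) \<subseteq> R k" using closed by (auto simp: R_def funpow_add)
  have "f k \<le> f (k + k)" using \<open>k > 0\<close> by (intro least) simp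
  then have "dim (K (k + k)) \<le> dim (K k)" "dim (R k) \<le> dim (R (k + k))"
    using dim_subset[OF K] dim_subset[OF R] dim_subset_UNIV[of "K (k + k)"]
    unfolding f_def by linarith+
  then have "K (k + k) = K k" "R (k + k) = R k"
    using subspace_dim_equal[OF subK subK K] subspace_dim_equal[OF subR subR R] by simp_all
  with \<open>k > 0\<close> show ?thesis unfolding K_def R_def by blast
qed

lemma fitting_decomposition:
  fixes T :: "'a::euclidean_space \<Rightarrow> 'a"
  assumes T: "linear T" and W: "subspace W" and inv: "\<And>x. x \<in> W \<Longrightarrow> T x \<in> W"
  shows "\<exists>k>0. {x \<in> W. (T ^^ k) x = 0} \<inter> (T ^^ k) ` W = {0} \<and>
    span ({x \<in> W. (T ^^ k) x = 0} \<union> (T ^^ k) ` W) = W"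
proof -
  obtain k where "k > 0" and ker: "{x \<in> W. (T ^^ (k + k)) x = 0} = {x \<in> W. (T ^^ k) x = 0}"
    and im: "(T ^^ (k + k)) ` W = (T ^^ k) ` W"
    using exists_stable_funpow[OF T W inv] by blast
  define S where "S = T ^^ k"
  have S: "linear S" unfolding S_def using linear_funpow[OF T] .
  have SW: "S x \<in> W" if "x \<in> W" for x unfolding S_def using funpow_closed[OF inv that] .
  have ker_S: "S x = 0" if "x \<in> W" "S (S x) = 0" for x
    using ker that by (auto simp: S_def funpow_add)
  have im_S: "\<exists>u\<in>W. S x = S (S u)" if "x \<in> W" for x
    using im imageI[OF that, of S] by (auto simp: S_def funpow_add)
  let ?K = "{x \<in> W. S x = 0}" and ?R = "S ` W"
  have "?K \<inter> ?R = {0}"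
    using ker_S subspace_0[OF W] linear_0[OF S] by force
  moreover have "span (?K \<union> ?R) = W"
  proof
    show "span (?K \<union> ?R) \<subseteq> W" using SW W by (intro span_minimal) auto
    show "W \<subseteq> span (?K \<union> ?R)"
    proof
      fix x assume x: "x \<in> W"
      then obtain u where u: "u \<in> W" "S x = S (S u)" using im_S by blast
      then have "x - S u \<in> ?K" "S u \<in> ?R"
        using x SW W linear_diff[OF S] by (simp_all add: subspace_diff)
      then have "(x - S u) + S u \<in> span (?K \<union> ?R)" by (intro span_add span_base) simp_all
      then show "x \<in> span (?K \<union> ?R)" by simp
    qed
  qed
  ultimately show ?thesis using \<open>k > 0\<close> unfolding S_def by blast
qed

definition indecomposable :: "'i set \<Rightarrow> ('i \<Rightarrow> 'a::real_vector \<Rightarrow> 'a) \<Rightarrow> 'a set \<Rightarrow> bool" where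
  "indecomposable I A W \<longleftrightarrow> (\<forall>U V. invariant_subspace I A U \<and> invariant_subspace I A V \<and>
     U \<inter> V = {0} \<and> span (U \<union> V) = W \<longrightarrow> U = {0} \<or> V = {0})"

lemma indecomposable_commutant_nilpotent:
  fixes A :: "'i \<Rightarrow> 'a::euclidean_space \<Rightarrow> 'a"
  assumes A: "commuting_family I A W" and indec: "indecomposable I A W"
    and T: "T \<in> commutant I A W" and y: "y \<in> W" "y \<noteq> 0" "T y = 0"
  shows "nilpotent_on W T"
proof -
  note D = commutantD[OF T]
  obtain k where "k > 0" and Int: "{x \<in> W. (T ^^ k) x = 0} \<inter> (T ^^ k) ` W = {0}"
    and span: "span ({x \<in> W. (T ^^ k) x = 0} \<union> (T ^^ k) ` W) = W"
    using fitting_decomposition[OF D(1) invariant_subspaceD(1)[OF commuting_familyD(2)[OF A]] D(2)]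
    by blast
  have "(T ^^ k) y = 0"
    using \<open>k > 0\<close> y(3) linear_0[OF linear_funpow[OF D(1)]] by (cases k) (simp_all add: funpow_swap1)
  then have "{x \<in> W. (T ^^ k) x = 0} \<noteq> {0}" using y by auto
  moreover have "{x \<in> W. (T ^^ k) x = 0} = {0} \<or> (T ^^ k) ` W = {0}"
    using indec invariant_subspace_kernel[OF A commutant_funpow[OF A T]]
      invariant_subspace_image[OF A commutant_funpow[OF A T]] Int span
    unfolding indecomposable_def by simp
  ultimately have "(T ^^ k) ` W = {0}" by simp
  then show ?thesis by (auto simp: nilpotent_on_def)
qed

section \<open>Inner products and traces in coordinates\<close>

text \<open>\<open>representation E x\<close> is zero for \<open>x\<close> outside \<open>span E\<close>, so this is an inner product only on
  \<open>span E\<close>, where it makes \<open>E\<close> orthonormal.\<close>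

definition basis_inner :: "'a::real_vector set \<Rightarrow> 'a \<Rightarrow> 'a \<Rightarrow> real" where
  "basis_inner E x y = (\<Sum>e\<in>E. representation E x e * representation E y e)"

definition basis_trace :: "'a::real_vector set \<Rightarrow> ('a \<Rightarrow> 'a) \<Rightarrow> real" where
  "basis_trace E A = (\<Sum>e\<in>E. representation E (A e) e)"

lemma representation_outside: "b \<notin> E \<Longrightarrow> representation E x b = 0"
  using representation_ne_zero[of E x b] by blast

lemma basis_inner_basis:
  assumes "finite E" "independent E" "e \<in> E"
  shows "basis_inner E e x = representation E x e"
  using assms
  by (simp add: basis_inner_def representation_basis if_distrib if_distribR cong: if_cong)

lemma basis_inner_scaleR:
  assumes "independent E" "x \<in> span E" "y \<in> span E"
  shows "basis_inner E (a *\<^sub>R x) (b *\<^sub>R y) = a * b * basis_inner E x y"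
  using assms by (simp add: basis_inner_def representation_scale sum_distrib_left mult_ac)

lemma inner_product_on_basis_inner:
  fixes E :: "'a::euclidean_space set"
  assumes E: "independent E" "span E = UNIV"
  shows "inner_product_on (basis_inner E)"
  unfolding inner_product_on_def
proof (intro conjI allI impI)
  note lin = representation_add[OF E(1)] representation_scale[OF E(1)]
  have "finite E" using E(1) by (rule independent_imp_finite)
  show "bilinear (basis_inner E)"
    unfolding bilinear_def linear_iff
    by (simp add: basis_inner_def lin E(2) algebra_simps sum.distrib sum_distrib_left)
  show "basis_inner E x y = basis_inner E y x" for x y by (simp add: basis_inner_def mult.commute)
  fix x :: 'a assume "x \<noteq> 0"
  then have "(\<Sum>e\<in>E. representation E x e *\<^sub>R e) \<noteq> 0"
    using sum_representation_eq[OF E(1) _ \<open>finite E\<close> order_refl] E(2) by simp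
  then obtain e where "e \<in> E" "representation E x e *\<^sub>R e \<noteq> 0"
    by (rule sum.not_neutral_contains_not_neutral)
  then show "basis_inner E x x > 0"
    unfolding basis_inner_def using \<open>finite E\<close>
    by (intro sum_pos2[of _ e]) (simp_all add: zero_less_mult_iff linorder_neq_iff disj_commute)
qed

lemma trace_map_rank_one:
  assumes "linear \<alpha>"
  shows "trace_map (\<lambda>x. \<alpha> x *\<^sub>R w) = \<alpha> w"
proof -
  have "\<alpha> w = \<alpha> (\<Sum>b\<in>Basis. (w \<bullet> b) *\<^sub>R b)" by (simp add: euclidean_representation)
  also have "\<dots> = (\<Sum>b\<in>Basis. (w \<bullet> b) * \<alpha> b)" using assms by (simp add: linear_sum linear_cmul)
  finally show ?thesis by (simp add: trace_map_def mult.commute)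
qed

lemma trace_map_eq_basis_trace:
  assumes E: "independent E" and A: "linear A" "\<And>x. A x \<in> span E"
  shows "trace_map A = basis_trace E A"
proof -
  have "finite E" using E by (rule independent_imp_finite)
  have coord: "linear (\<lambda>x. representation E (A x) e)" for e
    using A
    by (auto intro!: linearI simp: linear_add linear_cmul representation_add representation_scale E)
  have "A = (\<lambda>x. \<Sum>e\<in>E. representation E (A x) e *\<^sub>R e)"
    using sum_representation_eq[OF E A(2) \<open>finite E\<close> order_refl] by (intro ext) simp
  then have "trace_map A = trace_map (\<lambda>x. \<Sum>e\<in>E. representation E (A x) e *\<^sub>R e)" by (rule arg_cong)
  also have "\<dots> = (\<Sum>e\<in>E. trace_map (\<lambda>x. representation E (A x) e *\<^sub>R e))"
    by (simp add: trace_map_def inner_sum_left sum.swap[of _ Basis])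
  also have "\<dots> = basis_trace E A"
    by (simp only: trace_map_rank_one[OF coord] basis_trace_def)
  finally show ?thesis .
qed

lemma independent_Un:
  fixes E F :: "'a::euclidean_space set"
  assumes "independent E" "independent F" "span E \<inter> span F = {0}"
  shows "independent (E \<union> F)" "E \<inter> F = {}"
proof -
  have fin: "finite E" "finite F" using assms independent_imp_finite by auto
  have "dim (E \<union> F) + dim (span E \<inter> span F) = dim E + dim F"
    using dim_sums_Int[OF subspace_span subspace_span, of E F] unfolding span_Un[symmetric] dim_span .
  then have "card (E \<union> F) \<le> dim (E \<union> F)"
    using assms fin card_Un_le[of E F] by (simp add: dim_eq_card_independent)
  then show "independent (E \<union> F)"
    using fin by (intro card_le_dim_spanning[OF order_refl span_superset]) simp_all
  have "E \<inter> F \<subseteq> {0}" using assms(3) span_superset[of E] span_superset[of F] by blast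
  moreover have "0 \<notin> E" using assms(1) dependent_zero[of E] by blast
  ultimately show "E \<inter> F = {}" by blast
qed

context
  fixes E F :: "'a::euclidean_space set"
  assumes EF: "independent (E \<union> F)" "E \<inter> F = {}"
begin

lemma representation_Un:
  assumes "x \<in> span E" "y \<in> span F"
  shows "representation (E \<union> F) (x + y) b = representation E x b + representation F y b"
proof -
  have "x \<in> span (E \<union> F)" "y \<in> span (E \<union> F)"
    using assms span_mono[of E "E \<union> F"] span_mono[of F "E \<union> F"] by auto
  then show ?thesis
    using representation_extend[OF EF(1) assms(1)] representation_extend[OF EF(1) assms(2)]
    by (simp add: representation_add[OF EF(1)])
qed

lemma basis_inner_Un:
  assumes "x \<in> span E" "x' \<in> span E" "y \<in> span F" "y' \<in> span F"
  shows "basis_inner (E \<union> F) (x + y) (x' + y') = basis_inner E x x' + basis_inner F y y'"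
proof -
  have fin: "finite E" "finite F" using independent_imp_finite[OF EF(1)] by simp_all
  have "e \<in> E \<Longrightarrow> representation F z e = 0" "e \<in> F \<Longrightarrow> representation E z e = 0" for e z
    using EF(2) by (auto intro: representation_outside)
  then show ?thesis
    using assms EF(2) fin
    by (simp add: basis_inner_def sum.union_disjoint representation_Un)
qed

lemma basis_trace_Un:
  assumes "\<And>e. e \<in> E \<Longrightarrow> A e \<in> span E" "\<And>e. e \<in> F \<Longrightarrow> A e \<in> span F"
  shows "basis_trace (E \<union> F) A = basis_trace E A + basis_trace F A"
proof -
  have fin: "finite E" "finite F" using independent_imp_finite[OF EF(1)] by simp_all
  have "representation (E \<union> F) (A e) = representation E (A e)" if "e \<in> E" for e
    using representation_extend[OF EF(1) assms(1)[OF that]] by simp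
  moreover have "representation (E \<union> F) (A e) = representation F (A e)" if "e \<in> F" for e
    using representation_extend[OF EF(1) assms(2)[OF that]] by simp
  ultimately show ?thesis using EF(2) fin by (simp add: basis_trace_def sum.union_disjoint)
qed

end

section \<open>Balanced frames\<close>

definition balanced_vector :: "'i set \<Rightarrow> ('i \<Rightarrow> 'a::real_vector \<Rightarrow> 'a) \<Rightarrow> 'a set \<Rightarrow> 'a \<Rightarrow> bool" where
  "balanced_vector I A E v \<longleftrightarrow> v \<in> span E \<and> basis_inner E v v = 1 \<and>
     (\<forall>i\<in>I. card E * basis_inner E v (A i v) = basis_trace E (A i))"

lemma balanced_vectorD:
  assumes "balanced_vector I A E v"
  shows "v \<in> span E" "basis_inner E v v = 1"
    "i \<in> I \<Longrightarrow> card E * basis_inner E v (A i v) = basis_trace E (A i)"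
  using assms unfolding balanced_vector_def by blast+

lemma balanced_vector_nonzero:
  assumes "balanced_vector I A E v"
  shows "v \<noteq> 0"
  using balanced_vectorD(2)[OF assms] by (auto simp: basis_inner_def representation_zero)

lemma balanced_vector_basis_nonempty:
  assumes "balanced_vector I A E v"
  shows "E \<noteq> {}"
  using balanced_vectorD(2)[OF assms] by (auto simp: basis_inner_def)

lemma balanced_vector_traceless:
  fixes E :: "'a::euclidean_space set"
  assumes "balanced_vector I A E v" "independent E" "i \<in> I" "basis_trace E (A i) = 0"
  shows "basis_inner E v (A i v) = 0"
proof -
  have "card E \<noteq> 0"
    using balanced_vector_basis_nonempty[OF assms(1)] independent_imp_finite[OF assms(2)] by simp
  then show ?thesis using balanced_vectorD(3)[OF assms(1,3)] assms(4) by simp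
qed

definition balanced_frame :: "'i set \<Rightarrow> ('i \<Rightarrow> 'a::real_vector \<Rightarrow> 'a) \<Rightarrow> 'a set \<Rightarrow> 'a set \<Rightarrow> bool" where
  "balanced_frame I A E B \<longleftrightarrow>
     independent E \<and> span B = span E \<and> (\<forall>v\<in>B. balanced_vector I A E v)"

lemma balanced_frameD:
  assumes "balanced_frame I A E B"
  shows "independent E" "span B = span E" "v \<in> B \<Longrightarrow> balanced_vector I A E v"
  using assms unfolding balanced_frame_def by blast+

lemma balanced_frame_constant_diagonal:
  fixes E :: "'a::euclidean_space set"
  assumes E: "independent E" and diag: "\<And>i e. i \<in> I \<Longrightarrow> e \<in> E \<Longrightarrow> A i e - a i *\<^sub>R e \<in> span (E - {e})"
  shows "balanced_frame I A E E"
proof -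
  note fin = independent_imp_finite[OF E]
  have entry: "representation E (A i e) e = a i" if "i \<in> I" "e \<in> E" for i e
  proof -
    let ?y = "A i e - a i *\<^sub>R e"
    have y: "?y \<in> span (E - {e})" using diag that .
    have "representation E ?y e = 0"
      unfolding representation_extend[OF E y Diff_subset] by (simp add: representation_outside)
    have "?y \<in> span E" "a i *\<^sub>R e \<in> span E"
      using subsetD[OF span_mono[OF Diff_subset] y] span_base[OF that(2)]
      by (simp_all only: span_scale)
    then have "representation E (?y + a i *\<^sub>R e) e
        = representation E ?y e + representation E (a i *\<^sub>R e) e"
      by (subst representation_add[OF E]) simp_all
    then show ?thesis
      using \<open>representation E ?y e = 0\<close> span_base[OF that(2)]
      by (simp add: representation_scale[OF E] representation_basis[OF E that(2)])
  qed
  then show ?thesis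
    using fin E
    by (simp add: balanced_frame_def balanced_vector_def basis_inner_basis basis_trace_def
        representation_basis span_base)
qed

lemma commuting_family_shift:
  assumes A: "commuting_family I A W"
  shows "commuting_family I (\<lambda>i x. A i x - a i *\<^sub>R x) W"
  unfolding commuting_family_def
proof (intro conjI ballI)
  note lin = commuting_familyD(1)[OF A] and W = invariant_subspaceD[OF commuting_familyD(2)[OF A]]
  show "linear (\<lambda>x. A i x - a i *\<^sub>R x)" if "i \<in> I" for i
    using lin[OF that] by (intro linear_compose_sub linear_scale_self)
  show "invariant_subspace I (\<lambda>i x. A i x - a i *\<^sub>R x) W"
    using W by (simp add: invariant_subspace_def subspace_diff subspace_scale)
  show "A i (A j x - a j *\<^sub>R x) - a i *\<^sub>R (A j x - a j *\<^sub>R x)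
      = A j (A i x - a i *\<^sub>R x) - a j *\<^sub>R (A i x - a i *\<^sub>R x)" if "i \<in> I" "j \<in> I" "x \<in> W" for i j x
    using commuting_familyD(3)[OF A that] lin[OF that(1)] lin[OF that(2)]
    by (simp add: linear_diff linear_cmul algebra_simps)
qed

lemma indecomposable_balanced_frame:
  fixes A :: "'i \<Rightarrow> 'a::euclidean_space \<Rightarrow> 'a"
  assumes A: "commuting_family I A W" and indec: "indecomposable I A W" and W: "W \<noteq> {0}"
  shows "\<exists>E. span E = W \<and> balanced_frame I A E E"
proof -
  note lin = commuting_familyD(1)[OF A] and WD = invariant_subspaceD[OF commuting_familyD(2)[OF A]]
  have "\<exists>z. nilpotent_on W (poly_map (A i) (conj_pair_poly z))" if i: "i \<in> I" for i
  proof -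
    obtain z x where "x \<in> W" "x \<noteq> 0" "poly_map (A i) (conj_pair_poly z) x = 0"
      using exists_conj_pair_singular[OF lin[OF i] WD(1) W WD(2)[OF i]] by blast
    then show ?thesis
      using indecomposable_commutant_nilpotent[OF A indec
          commutant_poly_map[OF A commuting_family_in_commutant[OF A i]]] by blast
  qed
  then obtain z where z: "\<And>i. i \<in> I \<Longrightarrow> nilpotent_on W (poly_map (A i) (conj_pair_poly (z i)))"
    by metis
  define D where "D i x = A i x - Re (z i) *\<^sub>R x" for i x
  have "commuting_family I D W" unfolding D_def by (rule commuting_family_shift[OF A])
  moreover have "imaginary_spectrum_on W (D i) (Im (z i))" if i: "i \<in> I" for i
    using z[OF i]
    unfolding imaginary_spectrum_on_def poly_map_conj_pair_poly[OF lin[OF i], abs_def] D_def .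
  ultimately obtain E where E: "zero_diagonal_basis I D E" "span E = W"
    using imaginary_family_zero_diagonal_basis[of I D W "\<lambda>i. Im (z i)"] by blast
  have "balanced_frame I A E E"
    using zero_diagonal_basisD[OF E(1)] unfolding D_def by (rule balanced_frame_constant_diagonal)
  with E(2) show ?thesis by blast
qed

lemma span_signed_combinations:
  fixes B C :: "'a::real_vector set"
  assumes "B \<noteq> {}" "C \<noteq> {}" "\<alpha> \<noteq> 0" "\<beta> \<noteq> 0"
  shows "span {\<alpha> *\<^sub>R v + s *\<^sub>R w |v w s. v \<in> B \<and> w \<in> C \<and> s \<in> {\<beta>, - \<beta>}} = span (B \<union> C)"
    (is "span ?S = _")
proof
  show "span ?S \<subseteq> span (B \<union> C)"
    by (intro span_minimal subspace_span) (auto intro!: span_add span_diff span_scale intro: span_base)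
  have "v \<in> span ?S" "w \<in> span ?S" if "v \<in> B" "w \<in> C" for v w
  proof -
    have S: "\<alpha> *\<^sub>R v + \<beta> *\<^sub>R w \<in> span ?S" "\<alpha> *\<^sub>R v + (- \<beta>) *\<^sub>R w \<in> span ?S"
      using that by (blast intro: span_base)+
    have "v = (1 / (2 * \<alpha>)) *\<^sub>R ((\<alpha> *\<^sub>R v + \<beta> *\<^sub>R w) + (\<alpha> *\<^sub>R v + (- \<beta>) *\<^sub>R w))"
      using assms(3) by (simp add: scaleR_add_right[symmetric] scaleR_2[symmetric])
    also have "\<dots> \<in> span ?S" by (rule span_scale[OF span_add[OF S]])
    finally show "v \<in> span ?S" .
    have "w = (1 / (2 * \<beta>)) *\<^sub>R ((\<alpha> *\<^sub>R v + \<beta> *\<^sub>R w) - (\<alpha> *\<^sub>R v + (- \<beta>) *\<^sub>R w))"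
      using assms(4) by (simp add: scaleR_add_right[symmetric] scaleR_2[symmetric])
    also have "\<dots> \<in> span ?S" by (rule span_scale[OF span_diff[OF S]])
    finally show "w \<in> span ?S" .
  qed
  then have "B \<union> C \<subseteq> span ?S" using assms(1,2) by blast
  then show "span (B \<union> C) \<subseteq> span ?S" by (intro span_minimal subspace_span)
qed

text \<open>The weights \<open>\<alpha>\<^sup>2\<close> and \<open>\<beta>\<^sup>2\<close> are proportional to the dimensions of the summands, so that the
  two mean diagonal entries combine to the mean over the sum.\<close>

lemma balanced_vector_Un:
  fixes E F :: "'a::euclidean_space set"
  assumes v: "balanced_vector I A E v" and w: "balanced_vector I A F w"
    and EF: "independent (E \<union> F)" "E \<inter> F = {}"
    and \<alpha>: "\<alpha>\<^sup>2 = card E / card (E \<union> F)" and \<beta>: "\<beta>\<^sup>2 = card F / card (E \<union> F)"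
    and lin: "\<And>i. i \<in> I \<Longrightarrow> linear (A i)"
    and inv: "\<And>i x. i \<in> I \<Longrightarrow> x \<in> span E \<Longrightarrow> A i x \<in> span E"
      "\<And>i x. i \<in> I \<Longrightarrow> x \<in> span F \<Longrightarrow> A i x \<in> span F"
  shows "balanced_vector I A (E \<union> F) (\<alpha> *\<^sub>R v + \<beta> *\<^sub>R w)"
proof -
  note vD = balanced_vectorD[OF v] and wD = balanced_vectorD[OF w]
  let ?u = "\<alpha> *\<^sub>R v + \<beta> *\<^sub>R w" and ?n = "real (card (E \<union> F))"
  have E: "independent E" "independent F" using independent_mono[OF EF(1)] by simp_all
  have fin: "finite (E \<union> F)" using independent_imp_finite[OF EF(1)] .
  then have card: "card (E \<union> F) \<noteq> 0" using balanced_vector_basis_nonempty[OF v] by simp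
  have inner: "?n * basis_inner (E \<union> F) ?u (\<alpha> *\<^sub>R x + \<beta> *\<^sub>R y)
      = card E * basis_inner E v x + card F * basis_inner F w y"
    if "x \<in> span E" "y \<in> span F" for x y
  proof -
    have "basis_inner (E \<union> F) ?u (\<alpha> *\<^sub>R x + \<beta> *\<^sub>R y)
        = \<alpha>\<^sup>2 * basis_inner E v x + \<beta>\<^sup>2 * basis_inner F w y"
      using that vD(1) wD(1)
      by (simp add: basis_inner_Un[OF EF] span_scale basis_inner_scaleR E power2_eq_square)
    then show ?thesis using card by (simp add: \<alpha> \<beta> field_simps)
  qed
  have "card (E \<union> F) = card E + card F"
    using fin EF(2) by (simp add: card_Un_disjoint)
  then have "?n * basis_inner (E \<union> F) ?u ?u = ?n * 1"
    using inner[OF vD(1) wD(1)] vD(2) wD(2) by simp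
  then have "basis_inner (E \<union> F) ?u ?u = 1" using card by simp
  moreover have "?n * basis_inner (E \<union> F) ?u (A i ?u) = basis_trace (E \<union> F) (A i)" if i: "i \<in> I" for i
  proof -
    have "A i ?u = \<alpha> *\<^sub>R A i v + \<beta> *\<^sub>R A i w" using lin[OF i] by (simp add: linear_add linear_cmul)
    then have "?n * basis_inner (E \<union> F) ?u (A i ?u) = basis_trace E (A i) + basis_trace F (A i)"
      using inner[OF inv(1)[OF i vD(1)] inv(2)[OF i wD(1)]] vD(3)[OF i] wD(3)[OF i] by simp
    also have "\<dots> = basis_trace (E \<union> F) (A i)"
      using inv[OF i] by (simp add: basis_trace_Un[OF EF] span_base)
    finally show ?thesis .
  qed
  moreover have "?u \<in> span (E \<union> F)"
    using vD(1) wD(1) subsetD[OF span_mono[of E "E \<union> F"]] subsetD[OF span_mono[of F "E \<union> F"]]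
    by (simp add: span_add span_scale)
  ultimately show ?thesis by (simp add: balanced_vector_def)
qed

lemma balanced_frame_Un:
  fixes E F :: "'a::euclidean_space set"
  assumes EB: "balanced_frame I A E B" and FC: "balanced_frame I A F C"
    and Int: "span E \<inter> span F = {0}" and ne: "B \<noteq> {}" "C \<noteq> {}"
    and lin: "\<And>i. i \<in> I \<Longrightarrow> linear (A i)"
    and inv: "\<And>i x. i \<in> I \<Longrightarrow> x \<in> span E \<Longrightarrow> A i x \<in> span E"
      "\<And>i x. i \<in> I \<Longrightarrow> x \<in> span F \<Longrightarrow> A i x \<in> span F"
  shows "\<exists>G. balanced_frame I A (E \<union> F) G"
proof -
  note E = balanced_frameD[OF EB] and F = balanced_frameD[OF FC]
  note EF = independent_Un[OF E(1) F(1) Int]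
  have "finite E" "finite F" using E(1) F(1) independent_imp_finite by auto
  moreover have "E \<noteq> {}" "F \<noteq> {}"
    using ne E(3) F(3) balanced_vector_basis_nonempty by blast+
  ultimately have card: "card E > 0" "card F > 0" "card (E \<union> F) > 0"
    by (simp_all add: card_gt_0_iff)
  define \<alpha> \<beta> where "\<alpha> = sqrt (card E / card (E \<union> F))" and "\<beta> = sqrt (card F / card (E \<union> F))"
  have nz: "\<alpha> \<noteq> 0" "\<beta> \<noteq> 0" and squares: "\<alpha>\<^sup>2 = card E / card (E \<union> F)" "\<beta>\<^sup>2 = card F / card (E \<union> F)"
    using card by (simp_all add: \<alpha>_def \<beta>_def)
  define G where "G = {\<alpha> *\<^sub>R v + s *\<^sub>R w |v w s. v \<in> B \<and> w \<in> C \<and> s \<in> {\<beta>, - \<beta>}}"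
  have "span G = span (E \<union> F)"
    unfolding G_def span_signed_combinations[OF ne nz] span_Un E(2) F(2) ..
  moreover have "balanced_vector I A (E \<union> F) u" if u: "u \<in> G" for u
  proof -
    obtain v w s where "u = \<alpha> *\<^sub>R v + s *\<^sub>R w" "v \<in> B" "w \<in> C" "s \<in> {\<beta>, - \<beta>}"
      using u unfolding G_def by blast
    moreover from this have "s\<^sup>2 = card F / card (E \<union> F)" using squares(2) by auto
    ultimately show ?thesis
      using balanced_vector_Un[OF E(3) F(3) EF squares(1) _ lin inv] by simp
  qed
  ultimately have "balanced_frame I A (E \<union> F) G" using EF(1) by (simp add: balanced_frame_def)
  then show ?thesis by (rule exI)
qed

lemma commuting_family_balanced_frame:
  fixes A :: "'i \<Rightarrow> 'a::euclidean_space \<Rightarrow> 'a"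
  assumes "commuting_family I A W"
  shows "\<exists>E B. span E = W \<and> balanced_frame I A E B"
  using assms
proof (induction "dim W" arbitrary: W rule: less_induct)
  case less
  note A = less.prems
  consider "W = {0}" | "W \<noteq> {0}" "indecomposable I A W" | "\<not> indecomposable I A W" by blast
  then show ?case
  proof cases
    case 1
    then have "span {} = W" "balanced_frame I A {} {}"
      by (simp_all add: balanced_frame_def independent_empty)
    then show ?thesis by blast
  next
    case 2
    then show ?thesis using indecomposable_balanced_frame[OF A] by blast
  next
    case 3
    then obtain U V where U: "invariant_subspace I A U" "U \<noteq> {0}"
      and V: "invariant_subspace I A V" "V \<noteq> {0}"
      and UV: "U \<inter> V = {0}" and W: "span (U \<union> V) = W"
      unfolding indecomposable_def by blast
    have sub: "U \<subseteq> W" "V \<subseteq> W" using W span_superset[of "U \<union> V"] by auto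
    have "U \<noteq> W" "V \<noteq> W" using sub UV U(2) V(2) by blast+
    then have "dim U < dim W" "dim V < dim W"
      using sub invariant_subspaceD(1)[OF U(1)] invariant_subspaceD(1)[OF V(1)]
        invariant_subspaceD(1)[OF commuting_familyD(2)[OF A]]
      by (simp_all add: dim_psubset_subspaces psubset_eq)
    moreover have "commuting_family I A U" "commuting_family I A V"
      using commuting_family_subset[OF A] U(1) V(1) sub by blast+
    ultimately obtain E B F C where E: "span E = U" "balanced_frame I A E B"
      and F: "span F = V" "balanced_frame I A F C"
      using less.hyps[of U] less.hyps[of V] by blast
    have ne: "B \<noteq> {}" "C \<noteq> {}"
      using E(1) F(1) U(2) V(2) balanced_frameD(2)[OF E(2)] balanced_frameD(2)[OF F(2)] by auto
    have "\<exists>G. balanced_frame I A (E \<union> F) G"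
      using UV invariant_subspaceD(2)[OF U(1)] invariant_subspaceD(2)[OF V(1)]
      by (intro balanced_frame_Un[OF E(2) F(2) _ ne commuting_familyD(1)[OF A]]) (simp_all add: E(1) F(1))
    moreover have "span (E \<union> F) = W"
      unfolding W[symmetric] E(1)[symmetric] F(1)[symmetric] span_Un span_span ..
    ultimately show ?thesis by blast
  qed
qed

section \<open>The derived algebra lies in an abelian nilradical\<close>

lemma lie_algebraD:
  assumes "lie_algebra br"
  shows "bilinear br" "linear (br x)" "br x y = - br y x"
    "br (br x y) z = br x (br y z) - br y (br x z)"
proof -
  show b: "bilinear br" using assms by (simp add: lie_algebra_def)
  then show "linear (br x)" by (simp add: bilinear_def)
  have sq: "br x x = 0" for x using assms by (simp add: lie_algebra_def)
  have anti: "br x y = - br y x" for x y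
    using sq[of "x + y"] sq[of x] sq[of y]
    by (simp add: bilinear_ladd[OF b] bilinear_radd[OF b] eq_neg_iff_add_eq_0 add.commute)
  show "br x y = - br y x" by (rule anti)
  have "br x (br y z) + br y (br z x) + br z (br x y) = 0"
    using assms by (simp add: lie_algebra_def)
  then show "br (br x y) z = br x (br y z) - br y (br x z)"
    using anti[of z x] anti[of z "br x y"] by (simp add: bilinear_rneg[OF b] algebra_simps)
qed

lemma lie_idealD:
  assumes "lie_algebra br" "lie_ideal br J"
  shows "subspace J" "y \<in> J \<Longrightarrow> br x y \<in> J" "y \<in> J \<Longrightarrow> br y x \<in> J"
  using assms(2) lie_algebraD(3)[OF assms(1), of y x] unfolding lie_ideal_def
  by (auto simp: subspace_neg)

lemma lie_ideal_iff_invariant_subspace: "lie_ideal br J \<longleftrightarrow> invariant_subspace UNIV br J"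
  unfolding lie_ideal_def invariant_subspace_def by blast

lemma bilinear_span_mem:
  assumes h: "bilinear h" and V: "subspace V"
    and mem: "\<And>x y. x \<in> X \<Longrightarrow> y \<in> Y \<Longrightarrow> h x y \<in> V" and x: "x \<in> span X" and y: "y \<in> span Y"
  shows "h x y \<in> V"
  using x
proof (induction rule: span_induct)
  case base
  show ?case
    using V
    by (auto simp: subspace_def bilinear_lzero[OF h] bilinear_ladd[OF h] bilinear_lmul[OF h])
next
  case (step x)
  show ?case
    using y
  proof (induction rule: span_induct)
    case base
    show ?case
      using V
      by (auto simp: subspace_def bilinear_rzero[OF h] bilinear_radd[OF h] bilinear_rmul[OF h])
  next
    case (step y)
    then show ?case using mem \<open>x \<in> X\<close> by blast
  qed
qed

lemma bracket_span_subset: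
  assumes "subspace V" "\<And>x y. x \<in> S \<Longrightarrow> y \<in> T \<Longrightarrow> br x y \<in> V"
  shows "bracket_span br S T \<subseteq> V"
  unfolding bracket_span_def using assms by (intro span_minimal) auto

lemma bracket_in_bracket_span: "x \<in> S \<Longrightarrow> y \<in> T \<Longrightarrow> br x y \<in> bracket_span br S T"
  unfolding bracket_span_def by (intro span_base) blast

lemma lie_ideal_span:
  assumes "lie_algebra br" "\<And>x y. y \<in> Y \<Longrightarrow> br x y \<in> span Y"
  shows "lie_ideal br (span Y)"
  unfolding lie_ideal_iff_invariant_subspace
  using lie_algebraD(2)[OF assms(1)] assms(2) by (intro invariant_subspace_span)

lemma lie_ideal_bracket_span:
  assumes lie: "lie_algebra br" and I: "lie_ideal br I" and J: "lie_ideal br J"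
  shows "lie_ideal br (bracket_span br I J)"
  unfolding bracket_span_def
proof (rule lie_ideal_span[OF lie])
  fix z w assume "w \<in> {br x y |x y. x \<in> I \<and> y \<in> J}"
  then obtain x y where w: "w = br x y" "x \<in> I" "y \<in> J" by blast
  have "br z w = br (br z x) y + br x (br z y)"
    using lie_algebraD(4)[OF lie, of z x y] w by simp
  also have "\<dots> \<in> bracket_span br I J"
    using w lie_idealD(2)[OF lie I] lie_idealD(2)[OF lie J] subspace_span
    unfolding bracket_span_def by (intro span_add span_base) blast+
  finally show "br z w \<in> span {br x y |x y. x \<in> I \<and> y \<in> J}" by (simp add: bracket_span_def)
qed

lemma commuting_family_ad:
  assumes lie: "lie_algebra br" and N: "lie_ideal br N" "abelian_sub br N"
    and SS: "\<And>s t. s \<in> S \<Longrightarrow> t \<in> S \<Longrightarrow> br s t \<in> N"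
  shows "commuting_family S br N"
  unfolding commuting_family_def
proof (intro conjI ballI)
  show "br s (br t x) = br t (br s x)" if "s \<in> S" "t \<in> S" "x \<in> N" for s t x
    using N(2) SS[OF that(1,2)] that(3) lie_algebraD(4)[OF lie, of s t x]
    by (simp add: abelian_sub_def)
qed (use lie_algebraD(2)[OF lie] lie_idealD[OF lie N(1)] in \<open>auto simp: invariant_subspace_def\<close>)

lemma nilpotent_sub_span_Un:
  assumes lie: "lie_algebra br" and N: "lie_ideal br N" "abelian_sub br N"
    and SS: "\<And>s t. s \<in> S \<Longrightarrow> t \<in> S \<Longrightarrow> br s t \<in> N"
    and nil: "\<And>s. s \<in> S \<Longrightarrow> nilpotent_on N (br s)"
  shows "nilpotent_sub br (span (S \<union> N))"
proof -
  note br = lie_algebraD[OF lie] and ND = lie_idealD[OF lie N(1)]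
  have abelian: "br x y = 0" if "x \<in> N" "y \<in> N" for x y
    using N(2) that by (simp add: abelian_sub_def)
  have comm: "commuting_family S br N" using lie N SS by (rule commuting_family_ad)
  obtain L where L: "nilpotent_flag S br N L" using commuting_nilpotent_flag[OF comm nil] by blast
  note flag = nilpotent_flagD[OF L]
  have "lower_central br (span (S \<union> N)) (Suc j) \<subseteq> L j" for j
  proof (induction j)
    case 0
    have "br x y \<in> N" if "x \<in> S \<union> N" "y \<in> S \<union> N" for x y
      using that SS ND(2,3) by auto
    then have "br x y \<in> N" if "x \<in> span (S \<union> N)" "y \<in> span (S \<union> N)" for x y
      using bilinear_span_mem[OF br(1) ND(1) _ that] by simp
    then show ?case using ND(1) by (simp add: flag(1) bracket_span_subset)
  next
    case (Suc j)
    have "br x y \<in> L (Suc j)" if "x \<in> S \<union> N" "y \<in> L j" for x y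
      using that(1)
    proof
      assume "x \<in> N"
      then have "br x y = 0" using abelian that(2) flag(4) by blast
      then show ?thesis using subspace_0[OF flag(3)] by simp
    qed (use flag(5) that(2) in blast)
    then have "br x y \<in> L (Suc j)" if "x \<in> span (S \<union> N)" "y \<in> L j" for x y
      using bilinear_span_mem[OF br(1) flag(3) _ that(1) span_base[OF that(2)], of "Suc j"] by simp
    then show ?case
      unfolding lower_central.simps(2)[of _ _ "Suc j"] using Suc.IH flag(3)
      by (intro bracket_span_subset) (simp_all add: subset_iff)
  qed
  moreover obtain n where "L n = {0}" using flag(2) by blast
  ultimately have "lower_central br (span (S \<union> N)) (Suc n) \<subseteq> {0}" by metis
  moreover have "0 \<in> lower_central br (span (S \<union> N)) (Suc n)"
    by (simp add: bracket_span_def span_zero)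
  ultimately have "lower_central br (span (S \<union> N)) (Suc n) = {0}" by blast
  then show ?thesis unfolding nilpotent_sub_def by (rule exI)
qed

text \<open>If \<open>s = [t, x]\<close> and \<open>[t, s]\<close> lies in the abelian ideal \<open>N\<close>, then \<open>ad s\<close> and \<open>ad t\<close> commute
  on \<open>N\<close>, so that \<open>ad s\<close> is nilpotent there by Jacobson's lemma.\<close>

lemma commutators_subset_abelian_nilradical:
  assumes lie: "lie_algebra br" and nilrad: "is_nilradical br N" and abelian: "abelian_sub br N"
    and SS: "\<And>s t. s \<in> S \<Longrightarrow> t \<in> S \<Longrightarrow> br s t \<in> N"
    and ideal: "\<And>x s. s \<in> S \<Longrightarrow> br x s \<in> span (S \<union> N)"
    and comm: "\<And>s. s \<in> S \<Longrightarrow> \<exists>t x. s = br t x \<and> br t s \<in> N"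
  shows "S \<subseteq> N"
proof -
  have N: "lie_ideal br N" using nilrad by (simp add: is_nilradical_def)
  note br = lie_algebraD[OF lie] and ND = lie_idealD[OF lie N]
  have "nilpotent_on N (br s)" if s: "s \<in> S" for s
  proof -
    obtain t x where tx: "s = br t x" "br t s \<in> N" using comm[OF s] by blast
    have "commutator_commuting (br t) (br x) N (br s)"
    proof (rule commutator_commuting.intro)
      show "br s v = br t (br x v) - br x (br t v)" for v unfolding tx(1) by (rule br(4))
      show "br t (br s v) = br s (br t v)" if "v \<in> N" for v
        using abelian tx(2) that br(4)[of t s v] by (simp add: abelian_sub_def)
    qed (use br(2) ND in simp_all)
    then show ?thesis by (rule commutator_commuting.commutator_nilpotent)
  qed
  then have "nilpotent_sub br (span (S \<union> N))"
    using SS by (intro nilpotent_sub_span_Un[OF lie N abelian])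
  moreover have "lie_ideal br (span (S \<union> N))"
    using ideal ND(2) by (intro lie_ideal_span[OF lie]) (auto intro: span_base)
  ultimately have "span (S \<union> N) \<subseteq> N" using nilrad by (simp add: is_nilradical_def)
  then show ?thesis using span_superset[of "S \<union> N"] by blast
qed

lemma bracket_mem_nilradical_if_abelian_modulo:
  assumes lie: "lie_algebra br" and nilrad: "is_nilradical br N" and abelian: "abelian_sub br N"
    and J: "lie_ideal br J" and JJ: "\<And>s t. s \<in> J \<Longrightarrow> t \<in> J \<Longrightarrow> br s t \<in> N" and t: "t \<in> J"
  shows "br t x \<in> N"
proof -
  note br = lie_algebraD[OF lie] and JD = lie_idealD[OF lie J]
  define S where "S = {br t x |t x. t \<in> J}"
  have SJ: "S \<subseteq> J" using JD(3) by (auto simp: S_def)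
  have "S \<subseteq> N"
  proof (rule commutators_subset_abelian_nilradical[OF lie nilrad abelian])
    show "br s t \<in> N" if "s \<in> S" "t \<in> S" for s t using that SJ JJ by blast
    show "\<exists>t x. s = br t x \<and> br t s \<in> N" if "s \<in> S" for s
      using that SJ JJ unfolding S_def by blast
    fix z s assume "s \<in> S"
    then obtain t x where s: "s = br t x" "t \<in> J" by (auto simp: S_def)
    have "br z s = br (br z t) x + br t (br z x)" using br(4)[of z t x] s by simp
    moreover have "br (br z t) x \<in> S" "br t (br z x) \<in> S" using s JD(2) unfolding S_def by blast+
    ultimately show "br z s \<in> span (S \<union> N)" by (simp add: span_add span_base)
  qed
  then show ?thesis using t unfolding S_def by blast
qed

lemma bracket_span_subset_abelian_nilradical:
  assumes lie: "lie_algebra br" and nilrad: "is_nilradical br N" and abelian: "abelian_sub br N"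
    and J: "lie_ideal br J"
    and derived: "bracket_span br (bracket_span br J J) (bracket_span br J J) \<subseteq> N"
  shows "bracket_span br J J \<subseteq> N"
proof -
  have N: "lie_ideal br N" using nilrad by (simp add: is_nilradical_def)
  let ?D = "bracket_span br J J" and ?S = "{br x y |x y. x \<in> J \<and> y \<in> J}"
  have SD: "?S \<subseteq> ?D" by (auto intro: bracket_in_bracket_span)
  have DD: "br s t \<in> N" if "s \<in> ?D" "t \<in> ?D" for s t
    using bracket_in_bracket_span[OF that] derived by (rule subsetD[rotated])
  have D: "br t x \<in> N" if "t \<in> ?D" for t x
    using lie_ideal_bracket_span[OF lie J J] DD that
    by (rule bracket_mem_nilradical_if_abelian_modulo[OF lie nilrad abelian])
  have D': "br x t \<in> N" if "t \<in> ?D" for t x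
    using D[OF that, of x] lie_algebraD(3)[OF lie, of x t] lie_idealD(1)[OF lie N]
    by (simp add: subspace_neg)
  have "?S \<subseteq> N"
  proof (rule commutators_subset_abelian_nilradical[OF lie nilrad abelian])
    show "br s t \<in> N" if "s \<in> ?S" "t \<in> ?S" for s t using that SD D by blast
    show "br x s \<in> span (?S \<union> N)" if "s \<in> ?S" for x s
      using that SD D' by (intro span_base) blast
    show "\<exists>t x. s = br t x \<and> br t s \<in> N" if "s \<in> ?S" for s using that SD D' by blast
  qed
  then show ?thesis using lie_idealD(1)[OF lie N] by (intro bracket_span_subset) blast+
qed

lemma bracket_in_abelian_nilradical:
  assumes lie: "lie_algebra br" and solvable: "solvable_lie br"
    and nilrad: "is_nilradical br N" and abelian: "abelian_sub br N"
  shows "br x y \<in> N"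
proof -
  have N: "subspace N" using nilrad by (simp add: is_nilradical_def lie_ideal_def)
  have ideal: "lie_ideal br (derived_series br n)" for n
    by (induction n) (simp_all add: lie_ideal_bracket_span[OF lie], simp add: lie_ideal_def)
  have "derived_series br 1 \<subseteq> N" if "derived_series br (Suc n) \<subseteq> N" for n
    using that
  proof (induction n)
    case (Suc n)
    then have "derived_series br (Suc n) \<subseteq> N"
      using bracket_span_subset_abelian_nilradical[OF lie nilrad abelian ideal[of n]] by simp
    then show ?case by (rule Suc.IH)
  qed simp
  moreover obtain n where "derived_series br n = {0}"
    using solvable by (auto simp: solvable_lie_def)
  then have "derived_series br (Suc n) \<subseteq> N"
    using subspace_0[OF N] bracket_span_subset[OF N, of "{0}" "{0}" br]
    by (simp add: bilinear_lzero[OF lie_algebraD(1)[OF lie]])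
  ultimately have "derived_series br 1 \<subseteq> N" by blast
  then show ?thesis using bracket_in_bracket_span[of x UNIV y UNIV br] by auto
qed

section \<open>Geodesic bases\<close>

lemma geodesic_basis_exists_if_spanning:
  assumes "span S = UNIV" "\<And>x. x \<in> S \<Longrightarrow> geodesic_element ip br x"
  shows "\<exists>B. geodesic_basis ip br B"
proof -
  obtain B where B: "B \<subseteq> S" "independent B" "S \<subseteq> span B" using maximal_independent_subset by blast
  then have "span B = UNIV" using assms(1) span_minimal[OF B(3) subspace_span] by blast
  then show ?thesis using B assms(2) unfolding geodesic_basis_def by blast
qed

lemma geodesic_element_in_subspace:
  assumes lie: "lie_algebra br" and derived: "\<And>x y. br x y \<in> span E"
    and F: "independent F" "finite F" "E \<subseteq> F"
    and v: "v \<in> span E" "v \<noteq> 0" and zero: "\<And>x. basis_inner E v (br x v) = 0"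
  shows "geodesic_element (basis_inner F) br v"
  unfolding geodesic_element_def
proof (intro conjI allI v(2))
  fix x
  note ext = representation_extend[OF F(1) _ F(3)] and E = independent_mono[OF F(1,3)]
  have "basis_inner F v (br v x) = basis_inner E v (br v x)"
    unfolding basis_inner_def ext[OF v(1)] ext[OF derived]
    using F(2,3) by (intro sum.mono_neutral_right) (auto simp: representation_outside)
  also have "\<dots> = - basis_inner E v (br x v)"
    using lie_algebraD(3)[OF lie, of v x] derived
    by (simp add: basis_inner_def representation_neg[OF E] sum_negf)
  finally show "basis_inner F v (br v x) = 0" by (simp add: zero)
qed

lemma geodesic_element_outside_derived:
  assumes derived: "\<And>x y. br x y \<in> span E"
    and F: "independent F" "finite F" "E \<subseteq> F" and v: "v \<in> F - E"
  shows "geodesic_element (basis_inner F) br v"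
proof -
  have "basis_inner F v (br v x) = 0" for x
    using v F(1,2) representation_extend[OF F(1) derived F(3)]
    by (simp add: basis_inner_basis representation_outside)
  moreover have "v \<noteq> 0" using v F(1) dependent_zero[of F] by blast
  ultimately show ?thesis by (simp add: geodesic_element_def)
qed

lemma geodesic_basis_exists_if_balanced_frame:
  fixes br :: "'a::euclidean_space \<Rightarrow> 'a \<Rightarrow> 'a"
  assumes lie: "lie_algebra br" and unimodular: "unimodular br"
    and derived: "\<And>x y. br x y \<in> span E" and frame: "balanced_frame UNIV br E B"
  shows "\<exists>ip. inner_product_on ip \<and> (\<exists>B. geodesic_basis ip br B)"
proof -
  note E = balanced_frameD[OF frame]
  have "basis_trace E (br x) = 0" for x
    using unimodular trace_map_eq_basis_trace[OF E(1) lie_algebraD(2)[OF lie] derived]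
    by (simp add: unimodular_def)
  then have zero: "basis_inner E v (br x v) = 0" if "v \<in> B" for v x
    using balanced_vector_traceless[OF E(3)[OF that] E(1) UNIV_I] by blast
  define F where "F = extend_basis E"
  have F: "independent F" "finite F" "E \<subseteq> F" "span F = UNIV"
    using E(1)
    by (auto simp: F_def independent_extend_basis extend_basis_superset independent_imp_finite)
  have "span (B \<union> (F - E)) = span (E \<union> (F - E))" unfolding span_Un E(2) ..
  then have "span (B \<union> (F - E)) = UNIV" using F(3,4) by (simp add: Un_absorb1)
  moreover have "geodesic_element (basis_inner F) br v" if "v \<in> B \<union> (F - E)" for v
    using that
  proof
    assume v: "v \<in> B"
    show ?thesis
      using balanced_vectorD(1)[OF E(3)[OF v]] balanced_vector_nonzero[OF E(3)[OF v]] zero[OF v]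
      by (rule geodesic_element_in_subspace[OF lie derived F(1-3)])
  qed (rule geodesic_element_outside_derived[OF derived F(1-3)])
  ultimately show ?thesis
    using inner_product_on_basis_inner[OF F(1,4)] geodesic_basis_exists_if_spanning by blast
qed

theorem theorem1p1:
  fixes br :: "'a::euclidean_space \<Rightarrow> 'a \<Rightarrow> 'a" and N :: "'a set"
  assumes "lie_algebra br"
    and "unimodular br"
    and "solvable_lie br"
    and "is_nilradical br N"
    and "abelian_sub br N"
  shows "\<exists>ip. inner_product_on ip \<and> (\<exists>B. geodesic_basis ip br B)"
proof -
  have derived: "br x y \<in> N" for x y
    by (rule bracket_in_abelian_nilradical[OF assms(1,3-5)])
  have "commuting_family UNIV br N"
    using assms(4) derived
    by (intro commuting_family_ad assms(1,5)) (simp_all add: is_nilradical_def)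
  then obtain E B where N: "span E = N" and frame: "balanced_frame UNIV br E B"
    using commuting_family_balanced_frame by blast
  show ?thesis
    by (rule geodesic_basis_exists_if_balanced_frame[OF assms(1,2) derived[folded N] frame])
qed

end
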